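(* Let $G$ be a finite simple outerplanar graph with maximum degree $\Delta(G)=3$. Then $\lambda_2^T(G)\leq 5$, i.e. $G$ admits a $(2,1)$-total labeling $f: V(G)\cup E(G)\to\{0,1,\ldots,5\}$.
   Context: A $(2,1)$-total labeling of a graph $G$ with labels in $\{0,1,\ldots,k\}$ is a map $f: V(G)\cup E(G)\to\{0,1,\ldots,k\}$ such that $|f(x)-f(y)|\ge 2$ whenever $x$ is a vertex and $y$ is an edge incident to $x$, and $|f(x)-f(y)|\ge 1$ whenever $x,y$ are two adjacent vertices or two distinct edges sharing an end vertex. The $(2,1)$-total labeling number $\lambda_2^T(G)$ is the minimum $k$ for which such a labeling exists. A graph is outerplanar if it can be drawn in the plane without edge crossings so that all vertices lie on the boundary of one face (the outer face). *)

theory Defs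
  imports "HOL-Analysis.Analysis"
begin

text \<open>A graph is given by its vertex set \<open>V\<close> and its set \<open>E\<close> of edges, an edge being the
  two-element set of its ends.\<close>

definition finite_simple_graph :: "'a set \<Rightarrow> 'a set set \<Rightarrow> bool" where
  "finite_simple_graph V E \<longleftrightarrow> finite V \<and> (\<forall>e\<in>E. e \<subseteq> V \<and> card e = 2)"

definition degree :: "'a set set \<Rightarrow> 'a \<Rightarrow> nat" where
  "degree E v = card {e \<in> E. v \<in> e}"

text \<open>Inserting 0 only matters for the graph without vertices.\<close>

definition max_degree :: "'a set \<Rightarrow> 'a set set \<Rightarrow> nat" where
  "max_degree V E = Max (insert 0 (degree E ` V))"

text \<open>A drawing places the vertices by \<open>p\<close> and draws the edge \<open>e\<close> as the arc \<open>c e\<close> (a continuous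
  injective image of the unit interval). An arc contains no vertices other than the ends of its
  edge, and two arcs meet only in common ends of their edges.\<close>

definition plane_drawing ::
  "'a set \<Rightarrow> 'a set set \<Rightarrow> ('a \<Rightarrow> complex) \<Rightarrow> ('a set \<Rightarrow> real \<Rightarrow> complex) \<Rightarrow> bool" where
  "plane_drawing V E p c \<longleftrightarrow>
     inj_on p V \<and>
     (\<forall>e\<in>E. arc (c e) \<and> {pathstart (c e), pathfinish (c e)} = p ` e \<and>
             path_image (c e) \<inter> p ` V = p ` e) \<and>
     (\<forall>e\<in>E. \<forall>e'\<in>E. e \<noteq> e' \<longrightarrow> path_image (c e) \<inter> path_image (c e') = p ` (e \<inter> e'))"

definition drawing_faces ::
  "'a set \<Rightarrow> 'a set set \<Rightarrow> ('a \<Rightarrow> complex) \<Rightarrow> ('a set \<Rightarrow> real \<Rightarrow> complex) \<Rightarrow> complex set set" where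
  "drawing_faces V E p c = components (- (p ` V \<union> (\<Union>e\<in>E. path_image (c e))))"

text \<open>The distinguished face may be any face, bounded or not. An inversion of the plane makes it
  the unbounded one, so requiring unboundedness would give the same class of graphs.\<close>

definition outerplanar :: "'a set \<Rightarrow> 'a set set \<Rightarrow> bool" where
  "outerplanar V E \<longleftrightarrow>
     (\<exists>p c. plane_drawing V E p c \<and> (\<exists>F\<in>drawing_faces V E p c. p ` V \<subseteq> frontier F))"

text \<open>Labels are given to vertices (\<open>Inl\<close>) and edges (\<open>Inr\<close>) by a single map on the disjoint
  union. The differences are taken in the integers, since subtraction of natural numbers
  truncates.\<close>

definition total_labeling_2_1 ::
  "'a set \<Rightarrow> 'a set set \<Rightarrow> nat \<Rightarrow> ('a + 'a set \<Rightarrow> nat) \<Rightarrow> bool" where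
  "total_labeling_2_1 V E k f \<longleftrightarrow>
     f \<in> V <+> E \<rightarrow> {0..k} \<and>
     (\<forall>v\<in>V. \<forall>e\<in>E. v \<in> e \<longrightarrow> \<bar>int (f (Inl v)) - int (f (Inr e))\<bar> \<ge> 2) \<and>
     (\<forall>u\<in>V. \<forall>v\<in>V. {u, v} \<in> E \<longrightarrow> \<bar>int (f (Inl u)) - int (f (Inl v))\<bar> \<ge> 1) \<and>
     (\<forall>e\<in>E. \<forall>e'\<in>E. e \<noteq> e' \<and> e \<inter> e' \<noteq> {} \<longrightarrow> \<bar>int (f (Inr e)) - int (f (Inr e'))\<bar> \<ge> 1)"

definition total_labeling_number_2_1 :: "'a set \<Rightarrow> 'a set set \<Rightarrow> nat" where
  "total_labeling_number_2_1 V E = (LEAST k. \<exists>f. total_labeling_2_1 V E k f)"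

end

theory Submission
  imports Defs
begin

text \<open>Induction on the number of vertices. By the Jordan curve theorem and Janiszewski's theorem, a
  connected set off a theta curve that touches two of its open arcs is separated from the third one by
  the cycle which the two arcs form. As all vertices lie on one face, this excludes subdivisions of
  \<open>K\<^bsub>2,3\<^esub>\<close> and cycles with crossing chords. If all degrees are 2 or 3, a smallest set of
  vertices that at most one edge leaves is therefore spanned by a cycle (a longest cycle in it has no
  ears), and a shortest chord of this cycle, or its closing edge, cuts off a triangle with a vertex of
  degree 2 or a path with two adjacent inner vertices of degree 2. Deleting such a piece leaves a
  smaller outerplanar graph, and extending a labelling of it amounts to a finite check after
  relabelling boundedly many vertices. The extension can fail only for a few labels of the two
  attaching vertices and edges. If the attaching vertices are adjacent, these do not occur once the
  attaching vertices themselves are relabelled. If they are distinct and not adjacent, they are first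
  joined by a new edge, which forces the attaching edges to get the same label and the attaching
  vertices to get different ones.\<close>

section \<open>Theta curves in the plane\<close>

text \<open>With labels 0 to 5, a vertex labelled 1, 2, 3 or 4 leaves exactly three labels for its
  edges, as many as it may have. There is no slack for a greedy extension, so the labels at the
  attaching vertices matter. Relabelling two adjacent attaching vertices is affordable: besides each
  other and the deleted piece, each has at most one further neighbour, whose label and edge label
  are the only constraints from outside. Attaching vertices that are not adjacent may have two
  further neighbours each, and here the new edge takes over. The price is that the induction passes
  through a graph that is not a subgraph of the given one. The induction hypothesis is therefore
  stated for a class of drawings that admits replacing a path by an edge, with the positions of the
  vertices and the set standing for the outer face kept fixed.\<close>

lemma connected_subset_inside:
  fixes X :: "'b::real_normed_vector set"
  assumes "connected S" "S \<inter> X = {}" "s \<in> S" "s \<in> inside X"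
  shows "S \<subseteq> inside X"
proof
  fix t assume "t \<in> S"
  then have "connected_component (- X) s t"
    unfolding connected_component_def using assms by blast
  then show "t \<in> inside X"
    using assms(4) inside_same_component by blast
qed

text \<open>The frontier of the inside lies in \<open>X\<close>, so a connected set caught inside
  can accumulate only at points of the inside or of \<open>X\<close>. All arguments about sides
  below use the inside in this form.\<close>

lemma closure_inside_trap:
  fixes X :: "'b::real_normed_vector set"
  assumes "connected S" "S \<inter> X = {}" "s \<in> S" "s \<in> inside X" "closed X" "q \<in> closure S" "q \<notin> X"
  shows "q \<in> inside X"
proof -
  have "closure S \<subseteq> closure (inside X)"
    by (intro closure_mono connected_subset_inside[OF assms(1-4)])
  then show ?thesis
    using closure_inside_subset[OF assms(5)] assms(6,7) by blast
qed

locale theta =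
  fixes a b :: complex and g1 g2 g3 :: "real \<Rightarrow> complex"
  assumes ab: "a \<noteq> b"
    and g1: "arc g1" "pathstart g1 = a" "pathfinish g1 = b"
    and g2: "arc g2" "pathstart g2 = a" "pathfinish g2 = b"
    and g3: "arc g3" "pathstart g3 = a" "pathfinish g3 = b"
    and g12: "path_image g1 \<inter> path_image g2 = {a, b}"
    and g13: "path_image g1 \<inter> path_image g3 = {a, b}"
    and g23: "path_image g2 \<inter> path_image g3 = {a, b}"
begin

text \<open>Together with \<open>swapped\<close> this generates all permutations of the three arcs,
  so each fact is proved for one cycle only.\<close>

lemma rotated: "theta a b g2 g3 g1"
  using theta_axioms unfolding theta_def by blast

lemma swapped: "theta a b g2 g1 g3"
  using theta_axioms unfolding theta_def by blast

lemma
  shows closed12: "closed (path_image g1 \<union> path_image g2)"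
    and compact12: "compact (path_image g1 \<union> path_image g2)"
    and jordan12: "inside (path_image g1 \<union> path_image g2) \<noteq> {}"
      "connected (inside (path_image g1 \<union> path_image g2))"
      "connected (outside (path_image g1 \<union> path_image g2))"
      "frontier (inside (path_image g1 \<union> path_image g2)) = path_image g1 \<union> path_image g2"
proof -
  show "closed (path_image g1 \<union> path_image g2)" "compact (path_image g1 \<union> path_image g2)"
    using g1 g2 by (auto intro!: compact_imp_closed compact_Un compact_arc_image)
  have im: "path_image (g1 +++ reversepath g2) = path_image g1 \<union> path_image g2"
    using g1 g2 by (simp add: path_image_join)
  have "simple_path (g1 +++ reversepath g2)"
    using g1 g2 g12 by (intro simple_path_join_loop) (auto simp: arc_reversepath)
  moreover have "pathfinish (g1 +++ reversepath g2) = pathstart (g1 +++ reversepath g2)"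
    using g1 g2 by simp
  ultimately show "inside (path_image g1 \<union> path_image g2) \<noteq> {}"
      "connected (inside (path_image g1 \<union> path_image g2))"
      "connected (outside (path_image g1 \<union> path_image g2))"
      "frontier (inside (path_image g1 \<union> path_image g2)) = path_image g1 \<union> path_image g2"
    using Jordan_inside_outside[of "g1 +++ reversepath g2"] by (simp_all add: im)
qed

lemma split:
  assumes "path_image g3 \<inter> inside (path_image g1 \<union> path_image g2) \<noteq> {}"
  shows "inside (path_image g1 \<union> path_image g3) \<union> inside (path_image g2 \<union> path_image g3) \<union>
    (path_image g3 - {a, b}) = inside (path_image g1 \<union> path_image g2)"
  using split_inside_simple_closed_curve[of g1 a b g2 g3] assms g1 g2 g3 g12 g13 g23 ab
  by (metis arc_imp_simple_path)

lemma split_cases: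
  assumes "path_image g3 \<inter> inside (path_image g1 \<union> path_image g2) \<noteq> {}"
    and "x \<in> inside (path_image g1 \<union> path_image g2)" "x \<notin> path_image g3"
  shows "x \<in> inside (path_image g1 \<union> path_image g3) \<or> x \<in> inside (path_image g2 \<union> path_image g3)"
  using split[OF assms(1)] assms(2,3) by auto

lemma split_subset:
  assumes "path_image g3 \<inter> inside (path_image g1 \<union> path_image g2) \<noteq> {}"
  shows "inside (path_image g1 \<union> path_image g3) \<subseteq> inside (path_image g1 \<union> path_image g2)"
    "inside (path_image g2 \<union> path_image g3) \<subseteq> inside (path_image g1 \<union> path_image g2)"
  using split[OF assms] by auto

lemma meet:
  shows "x \<in> path_image g1 - {a, b} \<Longrightarrow> x \<notin> path_image g2 \<union> path_image g3"
    "x \<in> path_image g2 - {a, b} \<Longrightarrow> x \<notin> path_image g1 \<union> path_image g3"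
    "x \<in> path_image g3 - {a, b} \<Longrightarrow> x \<notin> path_image g1 \<union> path_image g2"
  using g12 g13 g23 by auto

lemma not_inside:
  "x \<in> path_image g1 \<union> path_image g2 \<Longrightarrow> x \<notin> inside (path_image g1 \<union> path_image g2)"
  using inside_no_overlap[of "path_image g1 \<union> path_image g2"] by blast

lemma interior3_disjoint: "(path_image g3 - {a, b}) \<inter> (path_image g1 \<union> path_image g2) = {}"
  using g13 g23 by blast

lemma interior3_inside:
  assumes "path_image g3 \<inter> inside (path_image g1 \<union> path_image g2) \<noteq> {}"
  shows "path_image g3 - {a, b} \<subseteq> inside (path_image g1 \<union> path_image g2)"
  using split[OF assms] by auto

text \<open>If \<open>g3\<close> ran inside the cycle, it would cut the inside into two parts. The
  part containing \<open>S\<close> is bounded by \<open>g3\<close> and only one of \<open>g1\<close>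
  and \<open>g2\<close>, so \<open>S\<close> could not come close to an inner point of the other
  arc.\<close>

lemma touching_both:
  assumes S: "connected S" "S \<inter> (path_image g1 \<union> path_image g2 \<union> path_image g3) = {}"
    and s: "s \<in> S" "s \<in> inside (path_image g1 \<union> path_image g2)"
    and q: "q1 \<in> closure S" "q1 \<in> path_image g1 - {a, b}" "q2 \<in> closure S" "q2 \<in> path_image g2 - {a, b}"
  shows "path_image g3 \<inter> inside (path_image g1 \<union> path_image g2) = {}"
proof (rule ccontr)
  assume "path_image g3 \<inter> inside (path_image g1 \<union> path_image g2) \<noteq> {}"
  then have g3in: "path_image g3 \<inter> inside (path_image g1 \<union> path_image g2) \<noteq> {}" .
  have cl: "closed (path_image g1 \<union> path_image g3)" "closed (path_image g2 \<union> path_image g3)"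
    using theta.closed12[OF rotated] theta.closed12[OF theta.swapped[OF theta.rotated[OF rotated]]]
    by (auto simp: Un_commute)
  have "s \<in> inside (path_image g1 \<union> path_image g3) \<or> s \<in> inside (path_image g2 \<union> path_image g3)"
    by (rule split_cases[OF g3in s(2)]) (use s(1) S(2) in auto)
  then have "q2 \<in> inside (path_image g1 \<union> path_image g3) \<or> q1 \<in> inside (path_image g2 \<union> path_image g3)"
  proof
    assume "s \<in> inside (path_image g1 \<union> path_image g3)"
    then show ?thesis
      using closure_inside_trap[OF S(1) _ s(1) _ cl(1) q(3) meet(2)[OF q(4)]] S(2) by auto
  next
    assume "s \<in> inside (path_image g2 \<union> path_image g3)"
    then show ?thesis
      using closure_inside_trap[OF S(1) _ s(1) _ cl(2) q(1) meet(1)[OF q(2)]] S(2) by auto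
  qed
  then have "q2 \<in> inside (path_image g1 \<union> path_image g2) \<or> q1 \<in> inside (path_image g1 \<union> path_image g2)"
    using split_subset[OF g3in] by auto
  then show False
    using q not_inside by auto
qed

text \<open>Otherwise a point \<open>x\<close> inside the cycle of \<open>g1\<close> and
  \<open>g2\<close> is outside both other cycles. A point \<open>y\<close> outside everything is
  then separated from \<open>x\<close> by neither of these two cycles. As they meet in the connected
  set \<open>path_image g3\<close>, Janiszewski's theorem says that their union does not separate
  \<open>x\<close> from \<open>y\<close> either, although the cycle of \<open>g1\<close> and
  \<open>g2\<close> does.\<close>

lemma one_arc_inside:
  assumes q: "q1 \<in> path_image g1 - {a, b}" "q2 \<in> path_image g2 - {a, b}"
  shows "path_image g1 \<inter> inside (path_image g2 \<union> path_image g3) \<noteq> {} \<or>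
    path_image g2 \<inter> inside (path_image g1 \<union> path_image g3) \<noteq> {} \<or>
    path_image g3 \<inter> inside (path_image g1 \<union> path_image g2) \<noteq> {}"
proof (rule ccontr)
  let ?I = "inside (path_image g1 \<union> path_image g2)"
  assume "\<not> ?thesis"
  then have no: "path_image g1 \<inter> inside (path_image g2 \<union> path_image g3) = {}"
    "path_image g2 \<inter> inside (path_image g1 \<union> path_image g3) = {}"
    "path_image g3 \<inter> ?I = {}" by auto
  have t31: "theta a b g1 g3 g2" and t23: "theta a b g2 g3 g1"
    using rotated theta.swapped[OF theta.rotated[OF rotated]] by auto
  obtain x where x: "x \<in> ?I" using jordan12(1) by blast
  have clI: "path_image g1 \<union> path_image g2 \<subseteq> closure ?I"
    using jordan12(4) by (metis closure_Un_frontier sup_ge2)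
  have dI: "?I \<inter> path_image g1 = {}" "?I \<inter> path_image g2 = {}" "?I \<inter> path_image g3 = {}"
    using not_inside no(3) by auto
  have "x \<notin> inside (path_image g1 \<union> path_image g3)"
  proof
    assume "x \<in> inside (path_image g1 \<union> path_image g3)"
    then have "q2 \<in> inside (path_image g1 \<union> path_image g3)"
      using closure_inside_trap[OF jordan12(2) _ x _ theta.closed12[OF t31] _ meet(2)[OF q(2)]] dI clI q(2)
      by (auto simp: Int_Un_distrib)
    then show False using no q by auto
  qed
  moreover have "x \<notin> inside (path_image g2 \<union> path_image g3)"
  proof
    assume "x \<in> inside (path_image g2 \<union> path_image g3)"
    then have "q1 \<in> inside (path_image g2 \<union> path_image g3)"
      using closure_inside_trap[OF jordan12(2) _ x _ theta.closed12[OF t23] _ meet(1)[OF q(1)]] dI clI q(1)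
      by (auto simp: Int_Un_distrib)
    then show False using no q by auto
  qed
  moreover have "x \<in> - (path_image g1 \<union> path_image g3)" "x \<in> - (path_image g2 \<union> path_image g3)"
    using x dI by auto
  ultimately have xo: "x \<in> outside (path_image g1 \<union> path_image g3)" "x \<in> outside (path_image g2 \<union> path_image g3)"
    by (metis Un_iff inside_Un_outside)+
  let ?T = "path_image g1 \<union> path_image g2 \<union> path_image g3"
  have "bounded ?T"
    using g1 g2 g3 by (simp add: bounded_arc_image)
  then obtain y where y: "y \<in> outside ?T"
    using unbounded_outside[of ?T] by fastforce
  have yo: "y \<in> outside (path_image g1 \<union> path_image g3)" "y \<in> outside (path_image g2 \<union> path_image g3)"
    "y \<in> outside (path_image g1 \<union> path_image g2)"
    using y outside_mono[of "path_image g1 \<union> path_image g3" ?T]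
    outside_mono[of "path_image g2 \<union> path_image g3" ?T]
    outside_mono[of "path_image g1 \<union> path_image g2" ?T] by auto
  have "connected_component (- ((path_image g1 \<union> path_image g3) \<union> (path_image g2 \<union> path_image g3))) x y"
  proof (rule Janiszewski)
    show "compact (path_image g1 \<union> path_image g3)" "closed (path_image g2 \<union> path_image g3)"
      using theta.compact12[OF t31] theta.closed12[OF t23] by auto
    have "(path_image g1 \<union> path_image g3) \<inter> (path_image g2 \<union> path_image g3) = path_image g3"
      using g12 g13 by auto
    then show "connected ((path_image g1 \<union> path_image g3) \<inter> (path_image g2 \<union> path_image g3))"
      using g3 by (simp add: connected_arc_image)
    show "connected_component (- (path_image g1 \<union> path_image g3)) x y"
      unfolding connected_component_def using theta.jordan12(3)[OF t31] xo(1) yo(1)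
      by (metis outside_no_overlap disjoint_eq_subset_Compl)
    show "connected_component (- (path_image g2 \<union> path_image g3)) x y"
      unfolding connected_component_def using theta.jordan12(3)[OF t23] xo(2) yo(2)
      by (metis outside_no_overlap disjoint_eq_subset_Compl)
  qed
  then have "connected_component (- (path_image g1 \<union> path_image g2)) x y"
    by (rule connected_component_of_subset) auto
  then have "y \<in> ?I" using x inside_same_component by blast
  then show False using yo(3) inside_Int_outside[of "path_image g1 \<union> path_image g2"] by blast
qed

text \<open>One direction is \<open>touching_both\<close>. For the other, if \<open>g3\<close> is
  not inside, then \<open>g1\<close> or \<open>g2\<close> lies inside the cycle of the other two
  arcs and cuts its inside in two. Touching that arc, \<open>S\<close> lies in one of the two parts,
  and only the part bounded by \<open>g1\<close> and \<open>g2\<close> has inner points of both arcs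
  on its boundary.\<close>

lemma separates:
  assumes S: "connected S" "S \<inter> (path_image g1 \<union> path_image g2 \<union> path_image g3) = {}" "s \<in> S"
    and q: "q1 \<in> closure S" "q1 \<in> path_image g1 - {a, b}" "q2 \<in> closure S" "q2 \<in> path_image g2 - {a, b}"
      "q3 \<in> path_image g3 - {a, b}"
  shows "s \<in> inside (path_image g1 \<union> path_image g2) \<longleftrightarrow> q3 \<notin> inside (path_image g1 \<union> path_image g2)"
proof
  assume "s \<in> inside (path_image g1 \<union> path_image g2)"
  then show "q3 \<notin> inside (path_image g1 \<union> path_image g2)"
    using touching_both[OF S(1,2,3) _ q(1-4)] q(5) by blast
next
  assume "q3 \<notin> inside (path_image g1 \<union> path_image g2)"
  then have "path_image g3 \<inter> inside (path_image g1 \<union> path_image g2) = {}"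
    using interior3_inside q(5) by auto
  then consider "path_image g1 \<inter> inside (path_image g2 \<union> path_image g3) \<noteq> {}"
    | "path_image g2 \<inter> inside (path_image g1 \<union> path_image g3) \<noteq> {}"
    using one_arc_inside[OF q(2,4)] by blast
  then show "s \<in> inside (path_image g1 \<union> path_image g2)"
  proof cases
    case 1
    have t: "theta a b g2 g3 g1" by (rule rotated)
    have t31: "theta a b g1 g3 g2" using rotated theta.swapped[OF theta.rotated[OF rotated]] by auto
    have "q1 \<in> inside (path_image g2 \<union> path_image g3)"
      using theta.interior3_inside[OF t 1] q(2) by auto
    then have "S \<inter> inside (path_image g2 \<union> path_image g3) \<noteq> {}"
      using q(1) open_inside[OF theta.closed12[OF t]] closure_iff_nhds_not_empty by blast
    then have "s \<in> inside (path_image g2 \<union> path_image g3)"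
      using connected_subset_inside[OF S(1), of "path_image g2 \<union> path_image g3"] S(2,3) by auto
    then consider "s \<in> inside (path_image g1 \<union> path_image g2)" | "s \<in> inside (path_image g1 \<union> path_image g3)"
      using theta.split_cases[OF t 1, of s] S(2,3) by (auto simp: Un_commute)
    then show ?thesis
    proof cases
      case 2
      have "q2 \<in> inside (path_image g1 \<union> path_image g3)"
        using closure_inside_trap[OF S(1) _ S(3) 2 theta.closed12[OF t31] q(3) meet(2)[OF q(4)]] S(2) by auto
      then have "q2 \<in> inside (path_image g2 \<union> path_image g3)"
        using theta.split_subset[OF t 1] by (auto simp: Un_commute)
      then show ?thesis
        using q(4) theta.not_inside[OF t] by auto
    qed
  next
    case 2
    have t: "theta a b g1 g3 g2" using rotated theta.swapped[OF theta.rotated[OF rotated]] by auto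
    have t23: "theta a b g2 g3 g1" by (rule rotated)
    have "q2 \<in> inside (path_image g1 \<union> path_image g3)"
      using theta.interior3_inside[OF t 2] q(4) by auto
    then have "S \<inter> inside (path_image g1 \<union> path_image g3) \<noteq> {}"
      using q(3) open_inside[OF theta.closed12[OF t]] closure_iff_nhds_not_empty by blast
    then have "s \<in> inside (path_image g1 \<union> path_image g3)"
      using connected_subset_inside[OF S(1), of "path_image g1 \<union> path_image g3"] S(2,3) by auto
    then consider "s \<in> inside (path_image g1 \<union> path_image g2)" | "s \<in> inside (path_image g2 \<union> path_image g3)"
      using theta.split_cases[OF t 2, of s] S(2,3) by (auto simp: Un_commute)
    then show ?thesis
    proof cases
      case 2
      have "q1 \<in> inside (path_image g2 \<union> path_image g3)"
        using closure_inside_trap[OF S(1) _ S(3) 2 theta.closed12[OF t23] q(1) meet(1)[OF q(2)]] S(2) by auto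
      then have "q1 \<in> inside (path_image g1 \<union> path_image g3)"
        using theta.split_subset[OF t \<open>path_image g2 \<inter> _ \<noteq> {}\<close>] by (auto simp: Un_commute)
      then show ?thesis
        using q(2) theta.not_inside[OF t] by auto
    qed
  qed
qed

end

section \<open>Drawings with all vertices on one face\<close>

fun path_edges :: "'a list \<Rightarrow> 'a set set" where
  "path_edges (x # y # r) = insert {x, y} (path_edges (y # r))"
| "path_edges _ = {}"

text \<open>A single vertex counts as a path from itself to itself. This puts \<open>d\<close> into
  the set \<open>D\<close> of \<open>hamiltonian_cycle\<close>.\<close>

definition path_between :: "'a set set \<Rightarrow> 'a \<Rightarrow> 'a list \<Rightarrow> 'a \<Rightarrow> bool" where
  "path_between E a xs b \<longleftrightarrow> xs \<noteq> [] \<and> hd xs = a \<and> last xs = b \<and> distinct xs \<and> path_edges xs \<subseteq> E"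

lemma path_edges_subset: "e \<in> path_edges xs \<Longrightarrow> e \<subseteq> set xs"
  by (induction xs rule: path_edges.induct) auto

lemma Union_path_edges: "2 \<le> length xs \<Longrightarrow> \<Union> (path_edges xs) = set xs"
proof (induction xs rule: path_edges.induct)
  case (1 x y r)
  then show ?case by (cases r) auto
qed auto

lemma path_edges_append:
  "path_edges (xs @ x # ys) = path_edges (xs @ [x]) \<union> path_edges (x # ys)"
  by (induction xs rule: path_edges.induct) auto

lemma path_edges_rev: "path_edges (rev xs) = path_edges xs"
proof (induction xs rule: path_edges.induct)
  case (1 x y r)
  then show ?case
    using path_edges_append[of "rev r" y "[x]"] by (auto simp: insert_commute)
qed auto

text \<open>For \<open>theta_of_paths\<close>: paths that share only their ends could have no common
  edge but the one joining these ends.\<close>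

lemma ends_not_path_edge:
  assumes "distinct xs" "3 \<le> length xs"
  shows "{hd xs, last xs} \<notin> path_edges xs"
proof
  assume e: "{hd xs, last xs} \<in> path_edges xs"
  obtain x y r where xs: "xs = x # y # r" "r \<noteq> []"
    using assms(2) by (metis Suc_le_length_iff eval_nat_numeral(3) length_Cons length_greater_0_conv numeral_2_eq_2 zero_less_Suc)
  have "x \<notin> set (y # r)" using assms xs by auto
  then have "{x, last r} \<notin> path_edges (y # r)"
    using path_edges_subset[of "{x, last r}" "y # r"] by auto
  moreover have "{x, last r} \<noteq> {x, y}"
    using assms(1) xs by (metis distinct.simps(2) doubleton_eq_iff last_in_set)
  ultimately show False using e xs by auto
qed

definition drawn :: "('a set \<Rightarrow> real \<Rightarrow> complex) \<Rightarrow> 'a set set \<Rightarrow> complex set" where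
  "drawn c A = (\<Union>e\<in>A. path_image (c e))"

text \<open>\<open>F\<close> stands for the distinguished face but is only asked to be a connected
  set off the edges with all vertices in its closure. Such a set serves unchanged for a subgraph and
  for an edge redrawn along a path, whereas the faces would have to be determined afresh.\<close>

definition outer_drawing ::
  "'a set \<Rightarrow> 'a set set \<Rightarrow> ('a \<Rightarrow> complex) \<Rightarrow> ('a set \<Rightarrow> real \<Rightarrow> complex) \<Rightarrow> complex set \<Rightarrow> bool" where
  "outer_drawing V E p c F \<longleftrightarrow> finite_simple_graph V E \<and> plane_drawing V E p c \<and>
     connected F \<and> F \<inter> drawn c E = {} \<and> p ` V \<subseteq> closure F"

lemma outer_drawing_exists:
  assumes "finite_simple_graph V E" "outerplanar V E"
  shows "\<exists>p c F. outer_drawing V E p c F"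
proof -
  obtain p c F where pc: "plane_drawing V E p c" and F: "F \<in> drawing_faces V E p c" "p ` V \<subseteq> frontier F"
    using assms(2) unfolding outerplanar_def by blast
  have "connected F" "F \<subseteq> - (p ` V \<union> drawn c E)"
    using F(1) in_components_connected in_components_subset unfolding drawing_faces_def drawn_def by blast+
  then show ?thesis
    using assms(1) pc F(2) unfolding outer_drawing_def frontier_def by blast
qed

lemma plane_drawingD:
  assumes "plane_drawing V E p c"
  shows "inj_on p V" "e \<in> E \<Longrightarrow> arc (c e)" "e \<in> E \<Longrightarrow> {pathstart (c e), pathfinish (c e)} = p ` e"
    "e \<in> E \<Longrightarrow> path_image (c e) \<inter> p ` V = p ` e"
    "e \<in> E \<Longrightarrow> e' \<in> E \<Longrightarrow> e \<noteq> e' \<Longrightarrow> path_image (c e) \<inter> path_image (c e') = p ` (e \<inter> e')"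
  using assms unfolding plane_drawing_def by simp_all

section \<open>Subgraphs excluded by an outer drawing\<close>

locale outer_drawn =
  fixes V :: "'a set" and E :: "'a set set" and p c F
  assumes outer: "outer_drawing V E p c F"
begin

lemma edge: "e \<in> E \<Longrightarrow> e \<subseteq> V" "e \<in> E \<Longrightarrow> card e = 2" "finite V"
  using outer unfolding outer_drawing_def finite_simple_graph_def by auto

lemma plane: "plane_drawing V E p c"
  using outer unfolding outer_drawing_def by simp

lemmas p_inj = plane_drawingD(1)[OF plane]
  and arc_edge = plane_drawingD(2,3)[OF plane]

lemma drawn_vertices:
  assumes "A \<subseteq> E"
  shows "drawn c A \<inter> p ` V = p ` \<Union> A"
proof -
  have "\<And>e. e \<in> A \<Longrightarrow> path_image (c e) \<inter> p ` V = p ` e"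
    using assms plane_drawingD(4)[OF plane] by (metis subsetD)
  then have "drawn c A \<inter> p ` V = (\<Union>e\<in>A. p ` e)"
    unfolding drawn_def by (simp add: Int_commute[of _ "p ` V"] Int_UN_distrib)
  then show ?thesis by (simp add: image_Union)
qed

lemma drawn_Int:
  assumes "A \<subseteq> E" "B \<subseteq> E" "A \<inter> B = {}"
  shows "drawn c A \<inter> drawn c B = p ` (\<Union> A \<inter> \<Union> B)"
proof -
  have "path_image (c e) \<inter> path_image (c e') = p ` (e \<inter> e')" if "e \<in> A" "e' \<in> B" for e e'
    by (rule plane_drawingD(5)[OF plane]) (use assms that in auto)
  then have "drawn c A \<inter> drawn c B = (\<Union>e\<in>A. \<Union>e'\<in>B. p ` (e \<inter> e'))"
    unfolding drawn_def by (simp add: Int_UN_distrib2)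
  moreover have "(\<Union>e\<in>A. \<Union>e'\<in>B. p ` (e \<inter> e')) = p ` (\<Union> A \<inter> \<Union> B)"
    by (rule equalityI; rule subsetI) fast+
  ultimately show ?thesis by simp
qed

lemma arc_of_edge:
  assumes "{x, y} \<in> E"
  shows "\<exists>g. arc g \<and> pathstart g = p x \<and> pathfinish g = p y \<and> path_image g = path_image (c {x, y})"
proof -
  have "{pathstart (c {x, y}), pathfinish (c {x, y})} = {p x, p y}"
    using arc_edge(2)[OF assms] by simp
  then consider "pathstart (c {x, y}) = p x" "pathfinish (c {x, y}) = p y"
    | "pathstart (c {x, y}) = p y" "pathfinish (c {x, y}) = p x"
    by (auto simp: doubleton_eq_iff)
  then show ?thesis
  proof cases
    case 1
    then show ?thesis using arc_edge(1)[OF assms] by blast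
  next
    case 2
    then show ?thesis
      using arc_edge(1)[OF assms]
      by (intro exI[of _ "reversepath (c {x, y})"]) (simp add: arc_reversepath)
  qed
qed

lemma path_set: "path_edges xs \<subseteq> E \<Longrightarrow> 2 \<le> length xs \<Longrightarrow> set xs \<subseteq> V"
  using Union_path_edges[of xs] edge(1) by blast

lemma arc_of_path:
  assumes "path_between E a xs b" "a \<noteq> b"
  shows "\<exists>g. arc g \<and> pathstart g = p a \<and> pathfinish g = p b \<and> path_image g = drawn c (path_edges xs)"
  using assms
proof (induction xs arbitrary: a rule: path_edges.induct)
  case (1 x y r)
  have E: "{x, y} \<in> E" "path_edges (y # r) \<subseteq> E" and [simp]: "a = x"
    using "1.prems" by (auto simp: path_between_def)
  obtain g where g: "arc g" "pathstart g = p x" "pathfinish g = p y" "path_image g = path_image (c {x, y})"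
    using arc_of_edge[OF E(1)] by blast
  show ?case
  proof (cases "r = []")
    case True
    then show ?thesis using g "1.prems" by (auto simp: path_between_def drawn_def)
  next
    case False
    have "y \<noteq> b" using "1.prems"(1) False by (auto simp: path_between_def)
    moreover have "path_between E y (y # r) b" using "1.prems"(1) E by (auto simp: path_between_def)
    ultimately obtain h where h: "arc h" "pathstart h = p y" "pathfinish h = p b"
      "path_image h = drawn c (path_edges (y # r))"
      using "1.IH" by blast
    have x: "x \<notin> set (y # r)" using "1.prems"(1) by (auto simp: path_between_def)
    \<comment> \<open>As \<open>x\<close> does not occur again on the path, the first edge meets the
      rest only in \<open>y\<close>, and joining the two arcs gives an arc.\<close>
    then have "drawn c {{x, y}} \<inter> drawn c (path_edges (y # r)) = p ` (\<Union> {{x, y}} \<inter> \<Union> (path_edges (y # r)))"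
      using E path_edges_subset[of "{x, y}" "y # r"] by (intro drawn_Int) auto
    also have "\<dots> = {p y}"
      using x False by (subst Union_path_edges) (cases r, auto)
    finally have "path_image g \<inter> path_image h = {p y}"
      using g h by (simp add: drawn_def)
    then have "arc (g +++ h)" "path_image (g +++ h) = path_image g \<union> path_image h"
      using g h by (simp_all add: arc_join path_image_join)
    then show ?thesis
      using g h by (intro exI[of _ "g +++ h"]) (auto simp: drawn_def)
  qed
qed (auto simp: path_between_def)

lemma arc_of_path_reversible:
  assumes "path_between E a xs b \<or> path_between E b xs a" "a \<noteq> b"
  shows "\<exists>g. arc g \<and> pathstart g = p a \<and> pathfinish g = p b \<and> path_image g = drawn c (path_edges xs)"
proof -
  have "path_between E a xs b \<or> path_between E a (rev xs) b"
    using assms(1) by (auto simp: path_between_def hd_rev last_rev path_edges_rev)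
  then show ?thesis
    using arc_of_path assms(2) path_edges_rev[of xs] by metis
qed

text \<open>At most one of the three paths may be the single edge between the hubs, since the first two
  have interior vertices.\<close>

lemma theta_of_paths:
  assumes xs: "path_between E a xs b \<or> path_between E b xs a" "3 \<le> length xs"
    and ys: "path_between E a ys b \<or> path_between E b ys a" "3 \<le> length ys"
    and zs: "path_between E a zs b \<or> path_between E b zs a"
    and d: "a \<noteq> b" "set xs \<inter> set ys = {a, b}" "set xs \<inter> set zs = {a, b}" "set ys \<inter> set zs = {a, b}"
  obtains g1 g2 g3 where "theta (p a) (p b) g1 g2 g3" "path_image g1 = drawn c (path_edges xs)"
    "path_image g2 = drawn c (path_edges ys)" "path_image g3 = drawn c (path_edges zs)"
proof -
  have E: "path_edges xs \<subseteq> E" "path_edges ys \<subseteq> E" "path_edges zs \<subseteq> E"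
    using xs ys zs by (auto simp: path_between_def)
  have "length zs \<noteq> 1" "zs \<noteq> []"
    using zs d(1) by (auto simp: path_between_def length_Suc_conv)
  then have lzs: "2 \<le> length zs" by (cases zs) (auto simp: Suc_le_eq neq_Nil_conv)
  have ends: "{a, b} \<notin> path_edges us"
    if "path_between E a us b \<or> path_between E b us a" "3 \<le> length us" for us
    using that ends_not_path_edge[of us] by (auto simp: path_between_def insert_commute)
  have disj: "path_edges us \<inter> path_edges vs = {}"
    if "{a, b} \<notin> path_edges us" "set us \<inter> set vs = {a, b}" "path_edges us \<subseteq> E" for us vs
  proof (rule ccontr)
    assume "path_edges us \<inter> path_edges vs \<noteq> {}"
    then obtain e where e: "e \<in> path_edges us" "e \<in> path_edges vs" by blast
    then have "e \<subseteq> {a, b}" using path_edges_subset that(2) by (metis le_inf_iff)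
    moreover have "card e = 2" using e that(3) edge(2) by blast
    ultimately have "e = {a, b}" using d(1) by (intro card_seteq) auto
    then show False using e that by blast
  qed
  have i: "drawn c (path_edges us) \<inter> drawn c (path_edges vs) = {p a, p b}"
    if "{a, b} \<notin> path_edges us" "set us \<inter> set vs = {a, b}" "path_edges us \<subseteq> E" "path_edges vs \<subseteq> E"
      "2 \<le> length us" "2 \<le> length vs" for us vs
    using drawn_Int[OF that(3,4) disj[OF that(1-3)]] that by (simp add: Union_path_edges)
  obtain g1 where g1: "arc g1" "pathstart g1 = p a" "pathfinish g1 = p b" "path_image g1 = drawn c (path_edges xs)"
    using arc_of_path_reversible[OF xs(1) d(1)] by blast
  obtain g2 where g2: "arc g2" "pathstart g2 = p a" "pathfinish g2 = p b" "path_image g2 = drawn c (path_edges ys)"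
    using arc_of_path_reversible[OF ys(1) d(1)] by blast
  obtain g3 where g3: "arc g3" "pathstart g3 = p a" "pathfinish g3 = p b" "path_image g3 = drawn c (path_edges zs)"
    using arc_of_path_reversible[OF zs d(1)] by blast
  have "a \<in> V" "b \<in> V" using d(2) path_set[OF E(1)] xs(2) by auto
  then have "p a \<noteq> p b" using d(1) p_inj by (auto dest: inj_onD)
  then have "theta (p a) (p b) g1 g2 g3"
    unfolding theta_def using g1 g2 g3 i[OF ends[OF xs] d(2) E(1,2)] i[OF ends[OF xs] d(3) E(1,3)]
      i[OF ends[OF ys] d(4) E(2,3)] xs ys lzs by simp
  then show ?thesis using that g1 g2 g3 by blast
qed

lemma vertex_on_path:
  assumes "path_edges xs \<subseteq> E" "2 \<le> length xs" "v \<in> set xs" "v \<noteq> a" "v \<noteq> b" "a \<in> V" "b \<in> V"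
  shows "p v \<in> drawn c (path_edges xs) - {p a, p b}"
proof -
  have "v \<in> V" using path_set[OF assms(1,2)] assms(3) by blast
  then have "p v \<noteq> p a" "p v \<noteq> p b" using assms p_inj by (auto dest: inj_onD)
  moreover have "p v \<in> drawn c (path_edges xs)"
    using drawn_vertices[OF assms(1)] assms(3) Union_path_edges[OF assms(2)] by (metis Int_iff imageI)
  ultimately show ?thesis by blast
qed

lemma face: "connected F" "p ` V \<subseteq> closure F" "A \<subseteq> E \<Longrightarrow> F \<inter> drawn c A = {}"
  using outer unfolding outer_drawing_def drawn_def by blast+

text \<open>\<open>F\<close> touches the first two paths at \<open>u\<close> and \<open>v\<close>,
  so it is separated from \<open>w\<close> by the cycle which they form. But \<open>w\<close> lies
  in the closure of \<open>F\<close> and off this cycle, so \<open>F\<close> together with the point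
  \<open>p w\<close> is connected and stays on one side.\<close>

lemma no_K23:
  assumes xs: "path_between E a xs b \<or> path_between E b xs a" "u \<in> set xs"
    and ys: "path_between E a ys b \<or> path_between E b ys a" "v \<in> set ys"
    and zs: "path_between E a zs b \<or> path_between E b zs a" "w \<in> set zs"
    and d: "a \<noteq> b" "set xs \<inter> set ys = {a, b}" "set xs \<inter> set zs = {a, b}" "set ys \<inter> set zs = {a, b}"
    and ne: "u \<noteq> a" "u \<noteq> b" "v \<noteq> a" "v \<noteq> b" "w \<noteq> a" "w \<noteq> b"
  shows False
proof -
  have len: "3 \<le> length us" if "{a, b} \<subseteq> set us" "t \<in> set us" "t \<noteq> a" "t \<noteq> b" for us t
  proof -
    have "card {a, b, t} \<le> card (set us)" using that by (intro card_mono) auto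
    then show ?thesis using card_length[of us] that d(1) by auto
  qed
  have l: "3 \<le> length xs" "3 \<le> length ys" "3 \<le> length zs"
    using len[of xs u] len[of ys v] len[of zs w] d ne xs(2) ys(2) zs(2) by blast+
  have E: "path_edges xs \<subseteq> E" "path_edges ys \<subseteq> E" "path_edges zs \<subseteq> E"
    using xs ys zs by (auto simp: path_between_def)
  have V: "set xs \<subseteq> V" "set ys \<subseteq> V" "set zs \<subseteq> V"
    using path_set E l by auto
  have ab: "a \<in> V" "b \<in> V" using d(2) V by auto
  obtain g1 g2 g3 where th: "theta (p a) (p b) g1 g2 g3" and im: "path_image g1 = drawn c (path_edges xs)"
    "path_image g2 = drawn c (path_edges ys)" "path_image g3 = drawn c (path_edges zs)"
    using theta_of_paths[OF xs(1) l(1) ys(1) l(2) zs(1) d] by blast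
  let ?Z = "path_image g1 \<union> path_image g2"
  have q: "p u \<in> path_image g1 - {p a, p b}" "p v \<in> path_image g2 - {p a, p b}" "p w \<in> path_image g3 - {p a, p b}"
    using vertex_on_path[OF E(1) _ xs(2) ne(1,2) ab] vertex_on_path[OF E(2) _ ys(2) ne(3,4) ab]
      vertex_on_path[OF E(3) _ zs(2) ne(5,6) ab] l by (auto simp: im)
  have cl: "p u \<in> closure F" "p v \<in> closure F" "p w \<in> closure F"
    using face(2) V xs(2) ys(2) zs(2) by blast+
  have disj: "F \<inter> (path_image g1 \<union> path_image g2 \<union> path_image g3) = {}"
    using face(3)[OF E(1)] face(3)[OF E(2)] face(3)[OF E(3)] by (auto simp: im)
  obtain s where s: "s \<in> F" using cl(1) by (cases "F = {}") auto
  have sep: "s \<in> inside ?Z \<longleftrightarrow> p w \<notin> inside ?Z"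
    using theta.separates[OF th face(1) disj s cl(1) q(1) cl(2) q(2,3)] .
  have pw: "p w \<notin> ?Z" using theta.interior3_disjoint[OF th] q(3) by blast
  have "connected (insert (p w) F)"
    by (rule connected_intermediate_closure[OF face(1)]) (use cl(3) closure_subset in auto)
  moreover have "insert (p w) F \<subseteq> - ?Z" using pw disj by auto
  ultimately have "connected_component (- ?Z) s (p w)" "connected_component (- ?Z) (p w) s"
    using s unfolding connected_component_def by blast+
  then show False
    using sep inside_same_component by blast
qed

text \<open>Here an edge without its ends becomes the connected set to which
  \<open>theta.separates\<close> is applied, in place of the face.\<close>

lemma open_edge:
  assumes "{u, v} \<in> E" "u \<noteq> v"
  obtains S r where "connected S" "r \<in> S" "S \<subseteq> path_image (c {u, v}) - {p u, p v}"
    "p u \<in> closure S" "p v \<in> closure S"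
proof -
  obtain g where g: "arc g" "pathstart g = p u" "pathfinish g = p v" "path_image g = path_image (c {u, v})"
    using arc_of_edge[OF assms(1)] by blast
  have cont: "continuous_on {0..1} g" and inj: "inj_on g {0..1}"
    using g(1) by (auto simp: arc_def path_def)
  have ends: "g 0 = p u" "g 1 = p v" using g by (auto simp: pathstart_def pathfinish_def)
  let ?S = "g ` {0<..<1}"
  have "connected ?S"
    by (rule connected_continuous_image) (use cont in \<open>auto intro: continuous_on_subset\<close>)
  moreover have "g (1/2) \<in> ?S" by (rule imageI) simp
  moreover have "?S \<subseteq> path_image (c {u, v}) - {p u, p v}"
  proof -
    have "g t \<noteq> g 0 \<and> g t \<noteq> g 1" if "t \<in> {0<..<1}" for t
      using inj_onD[OF inj, of t 0] inj_onD[OF inj, of t 1] that by auto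
    moreover have "?S \<subseteq> path_image g" unfolding path_image_def by auto
    ultimately show ?thesis unfolding g(4)[symmetric] ends[symmetric] by auto
  qed
  moreover have "g ` closure {0<..<1} \<subseteq> closure ?S"
    by (rule image_closure_subset) (use cont closure_subset[of ?S] in auto)
  then have "p u \<in> closure ?S" "p v \<in> closure ?S"
    unfolding ends[symmetric] by (auto simp: image_subset_iff)
  ultimately show ?thesis using that by blast
qed

text \<open>The outer face and the open edges \<open>ab\<close> and \<open>uv\<close> would lie pairwise on different sides of
  the cycle through \<open>a\<close>, \<open>u\<close>, \<open>b\<close>, \<open>v\<close>.\<close>

lemma no_crossing_chords:
  assumes xs: "path_between E a xs b \<or> path_between E b xs a" "u \<in> set xs"
    and ys: "path_between E a ys b \<or> path_between E b ys a" "v \<in> set ys"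
    and xs': "path_between E u xs' v \<or> path_between E v xs' u" "a \<in> set xs'"
    and ys': "path_between E u ys' v \<or> path_between E v ys' u" "b \<in> set ys'"
    and chords: "{a, b} \<in> E" "{u, v} \<in> E"
    and d: "distinct [a, b, u, v]" "set xs \<inter> set ys = {a, b}" "set xs' \<inter> set ys' = {u, v}"
    and same: "path_edges xs \<union> path_edges ys = path_edges xs' \<union> path_edges ys'"
  shows False
proof -
  have len: "3 \<le> length us" if "{x, y} \<subseteq> set us" "t \<in> set us" "t \<noteq> x" "t \<noteq> y" "x \<noteq> y" for us and x y t :: 'a
  proof -
    have "card {x, y, t} \<le> card (set us)" using that by (intro card_mono) auto
    then show ?thesis using card_length[of us] that by auto
  qed
  have l: "3 \<le> length xs" "3 \<le> length ys" "3 \<le> length xs'" "3 \<le> length ys'"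
    using len[of a b xs u] len[of a b ys v] len[of u v xs' a] len[of u v ys' b] d xs(2) ys(2) xs'(2) ys'(2)
    by auto
  have E: "path_edges xs \<subseteq> E" "path_edges ys \<subseteq> E" "path_edges xs' \<subseteq> E" "path_edges ys' \<subseteq> E"
    using xs ys xs' ys' by (auto simp: path_between_def)
  have V: "a \<in> V" "b \<in> V" "u \<in> V" "v \<in> V"
    using edge(1)[OF chords(1)] edge(1)[OF chords(2)] by auto
  have pV: "p a \<in> closure F" "p b \<in> closure F" "p u \<in> closure F" "p v \<in> closure F"
    using face(2) V by auto
  have edges: "path_between E a [a, b] b" "path_between E u [u, v] v"
    using chords d by (auto simp: path_between_def)
  have uv: "u \<notin> set ys" "v \<notin> set xs" and ab: "a \<notin> set ys'" "b \<notin> set xs'"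
    using d xs(2) ys(2) xs'(2) ys'(2) by auto
  have sub: "{a, b} \<subseteq> set xs" "{a, b} \<subseteq> set ys" "{u, v} \<subseteq> set xs'" "{u, v} \<subseteq> set ys'"
    using d by blast+
  obtain g1 g2 g3 where th: "theta (p a) (p b) g1 g2 g3" and im: "path_image g1 = drawn c (path_edges xs)"
    "path_image g2 = drawn c (path_edges ys)" "path_image g3 = drawn c (path_edges [a, b])"
    by (rule theta_of_paths[OF xs(1) l(1) ys(1) l(2) disjI1[OF edges(1)]]) (use d sub in auto)
  obtain h1 h2 h3 where th': "theta (p u) (p v) h1 h2 h3" and im': "path_image h1 = drawn c (path_edges xs')"
    "path_image h2 = drawn c (path_edges ys')" "path_image h3 = drawn c (path_edges [u, v])"
    by (rule theta_of_paths[OF xs'(1) l(3) ys'(1) l(4) disjI1[OF edges(2)]]) (use d sub in auto)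
  \<comment> \<open>The two theta curves contain the same cycle, once cut at \<open>a\<close>,
    \<open>b\<close> and once at \<open>u\<close>, \<open>v\<close>. Their insides can therefore be
    compared.\<close>
  have Z: "path_image g1 \<union> path_image g2 = path_image h1 \<union> path_image h2"
    using arg_cong[OF same, of "drawn c"] by (simp add: im im' drawn_def)
  obtain S r where S: "connected S" "r \<in> S" "S \<subseteq> path_image (c {u, v}) - {p u, p v}"
    "p u \<in> closure S" "p v \<in> closure S"
    using open_edge[OF chords(2)] d by auto
  obtain t where t: "t \<in> path_image (c {a, b}) - {p a, p b}"
    using open_edge[OF chords(1)] d by (metis distinct_length_2_or_more subsetD)
  obtain s where s: "s \<in> F" using pV(1) by (cases "F = {}") auto
  have q: "p u \<in> path_image g1 - {p a, p b}" "p v \<in> path_image g2 - {p a, p b}"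
    "p a \<in> path_image h1 - {p u, p v}" "p b \<in> path_image h2 - {p u, p v}"
    using vertex_on_path[OF E(1) _ xs(2) _ _ V(1,2)] vertex_on_path[OF E(2) _ ys(2) _ _ V(1,2)]
      vertex_on_path[OF E(3) _ xs'(2) _ _ V(3,4)] vertex_on_path[OF E(4) _ ys'(2) _ _ V(3,4)] l d
    by (auto simp: im im')
  have q3: "t \<in> path_image g3 - {p a, p b}" "r \<in> path_image h3 - {p u, p v}"
    using t S by (auto simp: im im' drawn_def)
  have "F \<inter> (path_image g1 \<union> path_image g2 \<union> path_image g3) = {}"
    "F \<inter> (path_image h1 \<union> path_image h2 \<union> path_image h3) = {}"
    using face(3)[OF E(1)] face(3)[OF E(2)] face(3)[OF E(3)] face(3)[OF E(4)]
      face(3)[of "path_edges [a, b]"] face(3)[of "path_edges [u, v]"] chords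
    by (auto simp: im im' Int_Un_distrib)
  then have 1: "s \<in> inside (path_image g1 \<union> path_image g2) \<longleftrightarrow> t \<notin> inside (path_image g1 \<union> path_image g2)"
    and 2: "s \<in> inside (path_image h1 \<union> path_image h2) \<longleftrightarrow> r \<notin> inside (path_image h1 \<union> path_image h2)"
    using theta.separates[OF th face(1) _ s pV(3) q(1) pV(4) q(2) q3(1)]
      theta.separates[OF th' face(1) _ s pV(1) q(3) pV(2) q(4) q3(2)] by auto
  have "S \<inter> drawn c A = {}" if "A \<subseteq> E" "{u, v} \<notin> A" for A
  proof -
    have "drawn c {{u, v}} \<inter> drawn c A \<subseteq> p ` {u, v}"
      using drawn_Int[of "{{u, v}}" A] chords(2) that by auto
    then show ?thesis using S(3) by (auto simp: drawn_def)
  qed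
  moreover have "{u, v} \<notin> path_edges xs" "{u, v} \<notin> path_edges ys" "{u, v} \<notin> path_edges [a, b]"
    using uv path_edges_subset[of "{u, v}" xs] path_edges_subset[of "{u, v}" ys] d
    by (auto simp: doubleton_eq_iff)
  ultimately have "S \<inter> (path_image g1 \<union> path_image g2 \<union> path_image g3) = {}"
    using E chords by (simp add: im Int_Un_distrib)
  \<comment> \<open>Third application of \<open>theta.separates\<close>, to the open edge
    \<open>uv\<close>, which touches the cycle at \<open>u\<close> and \<open>v\<close>. Three
    points cannot lie pairwise on different sides of one cycle.\<close>
  then have "r \<in> inside (path_image g1 \<union> path_image g2) \<longleftrightarrow> t \<notin> inside (path_image g1 \<union> path_image g2)"
    using theta.separates[OF th S(1) _ S(2) S(4) q(1) S(5) q(2) q3(1)] by auto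
  then show False using 1 2 Z by auto
qed

end

section \<open>Drawings of smaller graphs\<close>

lemma finite_simple_subgraph:
  assumes "finite_simple_graph V E" "V' \<subseteq> V" "E' \<subseteq> E" "\<And>e. e \<in> E' \<Longrightarrow> e \<subseteq> V'"
  shows "finite_simple_graph V' E'"
  using assms unfolding finite_simple_graph_def by (auto intro: finite_subset)

lemma outer_drawing_subgraph:
  assumes "outer_drawing V E p c F" "V' \<subseteq> V" "E' \<subseteq> E" "\<And>e. e \<in> E' \<Longrightarrow> e \<subseteq> V'"
  shows "outer_drawing V' E' p c F"
proof -
  have pl: "plane_drawing V E p c" using assms(1) unfolding outer_drawing_def by blast
  have "path_image (c e) \<inter> p ` V' = p ` e" if "e \<in> E'" for e
  proof -
    have "path_image (c e) \<inter> p ` V' = path_image (c e) \<inter> p ` V \<inter> p ` V'" using assms(2) by auto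
    also have "\<dots> = p ` e \<inter> p ` V'" using that assms(3) plane_drawingD(4)[OF pl] by (metis subsetD)
    also have "\<dots> = p ` e" using assms(4)[OF that] by auto
    finally show ?thesis .
  qed
  then have "plane_drawing V' E' p c"
    unfolding plane_drawing_def using plane_drawingD(1,2,3,5)[OF pl] assms(2,3) inj_on_subset by (metis subsetD)
  moreover have "F \<inter> drawn c E' = {}" "p ` V' \<subseteq> closure F" "connected F"
    using assms(1-3) unfolding outer_drawing_def drawn_def by blast+
  moreover have "finite_simple_graph V' E'"
    by (rule finite_simple_subgraph[OF _ assms(2-4)]) (use assms(1) in \<open>auto simp: outer_drawing_def\<close>)
  ultimately show ?thesis unfolding outer_drawing_def by blast
qed

text \<open>The new edge is drawn along the old path. Nothing is drawn where nothing was drawn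
  before, so \<open>F\<close> still avoids all edges, and the inner vertices of the path are no
  longer in \<open>V'\<close>.\<close>

lemma outer_drawing_shortcut:
  assumes outer: "outer_drawing V E p c F" and sub: "V' \<subseteq> V" "E' \<subseteq> E" "\<And>e. e \<in> E' \<Longrightarrow> e \<subseteq> V'"
    and us: "path_between E a us b" "set us \<inter> V' = {a, b}" "a \<noteq> b" "{a, b} \<notin> E'"
  shows "\<exists>c'. outer_drawing V' (insert {a, b} E') p c' F"
proof -
  interpret outer_drawn V E p c F using outer by unfold_locales
  obtain g where g: "arc g" "pathstart g = p a" "pathfinish g = p b" "path_image g = drawn c (path_edges us)"
    using arc_of_path[OF us(1,3)] by blast
  have usE: "path_edges us \<subseteq> E" using us(1) by (simp add: path_between_def)
  have "length us \<noteq> 1" "us \<noteq> []"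
    using us by (auto simp: path_between_def length_Suc_conv)
  then have len: "2 \<le> length us" by (cases us) (auto simp: Suc_le_eq neq_Nil_conv)
  have V': "a \<in> V'" "b \<in> V'" using us(2) by auto
  have base: "outer_drawing V' E' p c F" by (rule outer_drawing_subgraph[OF outer sub])
  then have pl: "plane_drawing V' E' p c" unfolding outer_drawing_def by blast
  \<comment> \<open>The path meets \<open>V'\<close> only in its ends, so an edge of it that belongs
    to \<open>E'\<close> could only be \<open>{a, b}\<close>.\<close>
  have new: "path_edges us \<inter> E' = {}"
  proof (rule ccontr)
    assume "path_edges us \<inter> E' \<noteq> {}"
    then obtain e where e: "e \<in> path_edges us" "e \<in> E'" by blast
    then have "e \<subseteq> {a, b}" using path_edges_subset[OF e(1)] sub(3)[OF e(2)] us(2) by blast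
    moreover have "card e = 2" using e(2) sub(2) edge(2) by blast
    ultimately have "e = {a, b}" using us(3) by (intro card_seteq) auto
    then show False using e(2) us(4) by blast
  qed
  define c' where "c' = c({a, b} := g)"
  have c': "c' {a, b} = g" "\<And>e. e \<in> E' \<Longrightarrow> c' e = c e"
    using us(4) by (auto simp: c'_def)
  have meetV: "path_image g \<inter> p ` V' = p ` {a, b}"
  proof -
    have "path_image g \<inter> p ` V = p ` set us"
      using drawn_vertices[OF usE] by (simp add: g Union_path_edges len)
    then have "path_image g \<inter> p ` V' = p ` set us \<inter> p ` V'" using sub(1) by blast
    also have "\<dots> = p ` (set us \<inter> V')"
      using p_inj sub(1) path_set[OF usE len] by (intro inj_on_image_Int[symmetric]) auto
    finally show ?thesis using us(2) by simp
  qed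
  have meetE: "path_image g \<inter> path_image (c e) = p ` ({a, b} \<inter> e)" if "e \<in> E'" for e
  proof -
    have "drawn c (path_edges us) \<inter> drawn c {e} = p ` (\<Union> (path_edges us) \<inter> \<Union> {e})"
      using that new sub(2) by (intro drawn_Int[OF usE]) auto
    moreover have "set us \<inter> e = {a, b} \<inter> e" using us(2) sub(3)[OF that] by blast
    ultimately show ?thesis by (simp add: g drawn_def Union_path_edges len)
  qed
  have "plane_drawing V' (insert {a, b} E') p c'"
    unfolding plane_drawing_def
  proof (intro conjI ballI impI)
    show "inj_on p V'" by (rule plane_drawingD(1)[OF pl])
  next
    fix e assume "e \<in> insert {a, b} E'"
    then consider "e = {a, b}" | "e \<in> E'" by blast
    then show "arc (c' e)" "{pathstart (c' e), pathfinish (c' e)} = p ` e"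
      "path_image (c' e) \<inter> p ` V' = p ` e"
      by (cases, use g c' plane_drawingD(2-4)[OF pl] meetV in simp_all)+
  next
    fix e e' assume e: "e \<in> insert {a, b} E'" "e' \<in> insert {a, b} E'" "e \<noteq> e'"
    then consider "e = {a, b}" "e' \<in> E'" | "e' = {a, b}" "e \<in> E'" | "e \<in> E'" "e' \<in> E'" by blast
    then show "path_image (c' e) \<inter> path_image (c' e') = p ` (e \<inter> e')"
    proof cases
      case 3
      then show ?thesis using plane_drawingD(5)[OF pl] e(3) c'(2) by simp
    next
      case 1
      then show ?thesis using meetE c' by simp
    next
      case 2
      then show ?thesis using meetE[of e] c' by (simp add: Int_commute)
    qed
  qed
  moreover have "F \<inter> drawn c' (insert {a, b} E') = {}"
  proof -
    have "drawn c' (insert {a, b} E') = drawn c (path_edges us) \<union> drawn c E'"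
      using c' g by (simp add: drawn_def)
    then show ?thesis using face(3)[OF usE] face(3)[OF sub(2)] by blast
  qed
  moreover have "finite_simple_graph V' (insert {a, b} E')"
    using base V' us(3) unfolding outer_drawing_def finite_simple_graph_def by auto
  ultimately show ?thesis
    using base unfolding outer_drawing_def by blast
qed

section \<open>Cycles and chords\<close>

definition nbrs :: "'a set set \<Rightarrow> 'a \<Rightarrow> 'a set" where
  "nbrs E v = {u. {v, u} \<in> E}"

definition boundary :: "'a set set \<Rightarrow> 'a set \<Rightarrow> 'a set set" where
  "boundary E S = {e \<in> E. e \<inter> S \<noteq> {} \<and> \<not> e \<subseteq> S}"

text \<open>The first vertex is not repeated in the list but only appended for the edges. Rotating
  the cycle is then exchanging two parts of the list.\<close>

definition cycle :: "'a set set \<Rightarrow> 'a list \<Rightarrow> bool" where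
  "cycle E xs \<longleftrightarrow> 3 \<le> length xs \<and> distinct xs \<and> path_edges (xs @ [hd xs]) \<subseteq> E"

lemma edge_other_end:
  assumes "finite_simple_graph V E" "e \<in> E" "v \<in> e"
  shows "\<exists>u\<in>V. u \<noteq> v \<and> e = {v, u}"
proof -
  have "card e = 2" "e \<subseteq> V" using assms unfolding finite_simple_graph_def by auto
  then show ?thesis using assms(3) by (auto simp: card_2_iff)
qed

lemma degree_eq_card_nbrs:
  assumes "finite_simple_graph V E"
  shows "degree E v = card (nbrs E v)"
proof -
  have "{e \<in> E. v \<in> e} = (\<lambda>u. {v, u}) ` nbrs E v"
    using edge_other_end[OF assms] by (fastforce simp: nbrs_def)
  moreover have "inj_on (\<lambda>u. {v, u}) (nbrs E v)"
    by (auto simp: inj_on_def doubleton_eq_iff)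
  ultimately show ?thesis unfolding degree_def by (simp add: card_image)
qed

lemma path_edges_prefix: "path_edges (A @ [z]) \<subseteq> path_edges (A @ z # C)"
  by (subst path_edges_append) simp

lemma path_edges_nth: "Suc i < length xs \<Longrightarrow> {xs ! i, xs ! Suc i} \<in> path_edges xs"
proof (induction xs arbitrary: i rule: path_edges.induct)
  case (1 x y r)
  then show ?case by (cases i) auto
qed auto

lemma cycle_edges:
  assumes "cycle E xs"
  shows "Suc i < length xs \<Longrightarrow> {xs ! i, xs ! Suc i} \<in> E" "{xs ! 0, xs ! (length xs - 1)} \<in> E"
proof -
  let ?ys = "xs @ [hd xs]"
  have E: "path_edges ?ys \<subseteq> E" and "xs \<noteq> []" using assms by (auto simp: cycle_def)
  show "{xs ! i, xs ! Suc i} \<in> E" if "Suc i < length xs"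
    using path_edges_nth[of i ?ys] E that by (auto simp: nth_append)
  show "{xs ! 0, xs ! (length xs - 1)} \<in> E"
    using path_edges_nth[of "length xs - 1" ?ys] E \<open>xs \<noteq> []\<close>
    by (auto simp: nth_append hd_conv_nth insert_commute)
qed

lemma cycle_rotate:
  assumes "cycle E (P @ Q)"
  shows "cycle E (Q @ P)"
proof (cases "P = [] \<or> Q = []")
  case False
  then obtain p P' q Q' where "P = p # P'" "Q = q # Q'" by (auto simp: neq_Nil_conv)
  then show ?thesis
    using assms path_edges_append[of "p # P'" q "Q' @ [p]"] path_edges_append[of "q # Q'" p "P' @ [q]"]
    by (auto simp: cycle_def)
qed (use assms in auto)

lemma drop_segment:
  assumes "i < k" "k < length xs"
  shows "drop i xs = xs ! i # take (k - i - 1) (drop (Suc i) xs) @ drop k xs"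
proof -
  have "drop k xs = drop (k - i - 1) (drop (Suc i) xs)" using assms by simp
  then show ?thesis using assms by (metis Cons_nth_drop_Suc append_take_drop_id less_trans)
qed

context outer_drawn
begin

lemma graph: "finite_simple_graph V E"
  using outer unfolding outer_drawing_def by blast

lemma adjacent: "{u, v} \<in> E \<Longrightarrow> u \<in> V" "{u, v} \<in> E \<Longrightarrow> v \<in> V" "{u, v} \<in> E \<Longrightarrow> u \<noteq> v"
  using edge(1)[of "{u, v}"] edge(2)[of "{u, v}"] by (auto simp: card_2_iff doubleton_eq_iff)

lemma finite_nbrs: "finite (nbrs E v)"
  by (rule finite_subset[of _ V]) (use adjacent edge(3) in \<open>auto simp: nbrs_def\<close>)

lemma cycle_paths:
  assumes "cycle E (a # A @ b # B)"
  shows "path_between E a (a # A @ [b]) b" "path_between E b (b # B @ [a]) a"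
  using assms path_edges_append[of "a # A" b "B @ [a]"] by (auto simp: cycle_def path_between_def)

text \<open>The ear and the two halves of the cycle are three paths between \<open>a\<close> and
  \<open>b\<close>, each with an inner vertex, as in \<open>no_K23\<close>.\<close>

lemma no_cycle_ear:
  assumes cyc: "cycle E (a # A @ b # B)" "A \<noteq> []" "B \<noteq> []"
    and ear: "path_between E a (a # us @ [b]) b" "us \<noteq> []" "set us \<inter> set (a # A @ b # B) = {}"
  shows False
proof -
  have "distinct (a # A @ b # B)" using cyc(1) by (simp add: cycle_def)
  then show False
    using cyc(2,3) ear hd_in_set[OF cyc(2)] hd_in_set[OF cyc(3)] hd_in_set[OF ear(2)]
    by (intro no_K23[OF disjI1[OF cycle_paths(1)[OF cyc(1)]] _ disjI2[OF cycle_paths(2)[OF cyc(1)]] _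
      disjI1[OF ear(1)], of "hd A" "hd B" "hd us"]) auto
qed

lemma no_cycle_crossing:
  assumes cyc: "cycle E (a # A @ u # B @ b # C @ v # D)" and "{a, b} \<in> E" "{u, v} \<in> E"
  shows False
proof -
  have c1: "cycle E (a # (A @ u # B) @ b # (C @ v # D))" using cyc by simp
  have c2: "cycle E (u # (B @ b # C) @ v # (D @ a # A))"
    using cycle_rotate[of E "a # A" "u # B @ b # C @ v # D"] cyc by simp
  have dist: "distinct (a # A @ u # B @ b # C @ v # D)" using cyc by (simp add: cycle_def)
  \<comment> \<open>The vertices \<open>a\<close>, \<open>u\<close>, \<open>b\<close>,
    \<open>v\<close> cut the cycle into four segments. Each path needed for
    \<open>no_crossing_chords\<close> consists of two consecutive segments, so both pairs of paths
    have the edge set \<open>?all\<close>.\<close>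
  let ?all = "path_edges (a # A @ [u]) \<union> path_edges (u # B @ [b]) \<union> path_edges (b # C @ [v]) \<union>
    path_edges (v # D @ [a])"
  have p1: "path_edges (a # (A @ u # B) @ [b]) = path_edges (a # A @ [u]) \<union> path_edges (u # B @ [b])"
    using path_edges_append[of "a # A" u "B @ [b]"] by simp
  have p2: "path_edges (b # (C @ v # D) @ [a]) = path_edges (b # C @ [v]) \<union> path_edges (v # D @ [a])"
    using path_edges_append[of "b # C" v "D @ [a]"] by simp
  have p3: "path_edges (v # (D @ a # A) @ [u]) = path_edges (v # D @ [a]) \<union> path_edges (a # A @ [u])"
    using path_edges_append[of "v # D" a "A @ [u]"] by simp
  have p4: "path_edges (u # (B @ b # C) @ [v]) = path_edges (u # B @ [b]) \<union> path_edges (b # C @ [v])"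
    using path_edges_append[of "u # B" b "C @ [v]"] by simp
  show False
    by (rule no_crossing_chords[OF disjI1[OF cycle_paths(1)[OF c1]] _ disjI2[OF cycle_paths(2)[OF c1]] _
        disjI2[OF cycle_paths(2)[OF c2]] _ disjI1[OF cycle_paths(1)[OF c2]] _ assms(2,3)])
      (use dist p1 p2 p3 p4 in auto)
qed

lemma no_cycle_crossing_nth:
  assumes "cycle E xs" "i < k" "k < j" "j < l" "l < length xs" "{xs ! i, xs ! j} \<in> E" "{xs ! k, xs ! l} \<in> E"
  shows False
proof -
  let ?seg = "\<lambda>i k. take (k - i - 1) (drop (Suc i) xs)"
  \<comment> \<open>After rotating \<open>xs ! i\<close> to the front, the four positions occur in
    the order that \<open>no_cycle_crossing\<close> expects.\<close>
  have "cycle E (drop i xs @ take i xs)"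
    using assms(1) cycle_rotate[of E "take i xs" "drop i xs"] by simp
  moreover have "drop i xs @ take i xs = xs ! i # ?seg i k @ xs ! k # ?seg k j @ xs ! j # ?seg j l @
      xs ! l # (drop (Suc l) xs @ take i xs)"
    using drop_segment[of i k xs] drop_segment[of k j xs] drop_segment[of j l xs]
      Cons_nth_drop_Suc[of l xs] assms by simp
  ultimately show False
    using no_cycle_crossing assms(6,7) by metis
qed

end

section \<open>Degrees 2 and 3, and sets left by at most one edge\<close>

locale subcubic = outer_drawn +
  assumes degree_le: "v \<in> V \<Longrightarrow> degree E v \<le> 3"
begin

lemma no_four_nbrs:
  assumes "{v, a} \<in> E" "{v, b} \<in> E" "{v, x} \<in> E" "{v, y} \<in> E" "distinct [a, b, x, y]"
  shows False
proof -
  have "card {a, b, x, y} \<le> card (nbrs E v)"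
    using assms finite_nbrs by (intro card_mono) (auto simp: nbrs_def)
  then show False
    using assms degree_le[of v] adjacent(1)[OF assms(1)] degree_eq_card_nbrs[OF graph, of v] by simp
qed

end

locale small_degree = subcubic +
  assumes degree_ge: "v \<in> V \<Longrightarrow> 2 \<le> degree E v"
begin

lemma degree_two:
  assumes "v \<in> V" "nbrs E v \<subseteq> {a, b}"
  shows "degree E v = 2"
proof -
  have "card (nbrs E v) \<le> card {a, b}" using assms(2) by (intro card_mono) auto
  also have "\<dots> \<le> 2" by (simp add: card_insert_if)
  finally show ?thesis
    using degree_ge[OF assms(1)] degree_eq_card_nbrs[OF graph, of v] by simp
qed

lemma other_nbr:
  assumes "v \<in> V"
  shows "\<exists>u. {v, u} \<in> E \<and> u \<noteq> w"
proof (rule ccontr)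
  assume "\<not> ?thesis"
  then have "card (nbrs E v) \<le> card {w}" by (intro card_mono) (auto simp: nbrs_def)
  then show False using degree_ge[OF assms] degree_eq_card_nbrs[OF graph, of v] by simp
qed

end

text \<open>In a graph with degrees at most 3 every cut vertex is an end of a bridge. Counting
  leaving edges instead of cut vertices therefore still finds a block at the end of the
  graph.\<close>

locale end_block = small_degree +
  fixes S
  assumes S: "S \<subseteq> V" "S \<noteq> {}" "card (boundary E S) \<le> 1"
    and minimal: "T \<subset> S \<Longrightarrow> T \<noteq> {} \<Longrightarrow> 1 < card (boundary E T)"
begin

lemma finite_E: "finite E"
proof -
  have "E \<subseteq> Pow V" using edge(1) by auto
  then show ?thesis using edge(3) finite_subset by auto
qed

lemma boundary_unique:
  assumes "e \<in> boundary E S" "e' \<in> boundary E S"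
  shows "e = e'"
proof -
  have "finite (boundary E S)" using finite_E unfolding boundary_def by simp
  then show ?thesis using S(3) assms by (auto simp: card_le_Suc0_iff_eq)
qed

text \<open>The two leaving edges coincide, and a leaving edge of this kind has only one end in
  \<open>S\<close>.\<close>

lemma leaving_unique:
  assumes "v \<in> S" "w \<in> S" "{v, x} \<in> E" "x \<notin> S" "{w, y} \<in> E" "y \<notin> S"
  shows "v = w"
proof -
  have "{v, x} = {w, y}" using assms by (intro boundary_unique) (auto simp: boundary_def)
  then show ?thesis using assms by (auto simp: doubleton_eq_iff)
qed

lemma nbr_inside:
  assumes "v \<in> S"
  shows "\<exists>u\<in>S. {v, u} \<in> E"
proof (rule ccontr)
  assume no: "\<not> ?thesis"
  have "v \<in> V" using assms S(1) by blast
  then obtain u where u: "{v, u} \<in> E" using other_nbr by blast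
  obtain w where w: "{v, w} \<in> E" "w \<noteq> u" using other_nbr \<open>v \<in> V\<close> by blast
  have "{v, u} = {v, w}" using no u w assms by (intro boundary_unique) (auto simp: boundary_def)
  then show False using w by (auto simp: doubleton_eq_iff)
qed

text \<open>Besides its successor the first vertex has another neighbour, since its degree is at
  least 2. That neighbour lies further along the path and closes a cycle.\<close>

lemma cycle_of_stuck_path:
  assumes xs: "distinct xs" "path_edges xs \<subseteq> E" "set xs \<subseteq> S" "2 \<le> length xs"
    and stuck: "nbrs E (hd xs) \<subseteq> set xs"
  shows "\<exists>ys. cycle E ys \<and> set ys \<subseteq> S"
proof -
  obtain x y r where xyr: "xs = x # y # r"
    using xs(4) by (cases xs rule: path_edges.cases) auto
  obtain z where z: "{x, z} \<in> E" "z \<noteq> y"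
    using other_nbr[of x y] xs(3) S(1) xyr by auto
  have "z \<noteq> x" using adjacent(3)[OF z(1)] by simp
  then have "z \<in> set r" using z stuck xyr by (auto simp: nbrs_def)
  then obtain A C where r: "r = A @ z # C" by (meson split_list)
  have "path_edges (x # y # A @ [z]) \<subseteq> E"
    using xs(2) path_edges_prefix[of "x # y # A" z C] by (auto simp: xyr r)
  moreover have "path_edges ((x # y # A) @ z # [x]) = path_edges ((x # y # A) @ [z]) \<union> path_edges [z, x]"
    by (rule path_edges_append)
  ultimately have "cycle E (x # y # A @ [z])"
    using xs(1) z(1) by (simp add: cycle_def xyr r insert_commute)
  moreover have "set (x # y # A @ [z]) \<subseteq> S" using xs(3) xyr r by auto
  ultimately show ?thesis by blast
qed

text \<open>A longest path in \<open>S\<close> cannot be prolonged within \<open>S\<close>. At most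
  one vertex of \<open>S\<close> has a neighbour outside \<open>S\<close>, so at one of the two ends
  all neighbours lie on the path.\<close>

lemma cycle_exists: "\<exists>xs. cycle E xs \<and> set xs \<subseteq> S"
proof -
  define P where "P xs \<longleftrightarrow> distinct xs \<and> path_edges xs \<subseteq> E \<and> set xs \<subseteq> S \<and> xs \<noteq> []" for xs
  obtain v where v: "v \<in> S" using S(2) by blast
  have finS: "finite S" using S(1) edge(3) finite_subset by blast
  have "P [v]" using v by (simp add: P_def)
  moreover have "\<forall>y. P y \<longrightarrow> length y < Suc (card S)"
    using finS by (auto simp: P_def less_Suc_eq_le distinct_card[symmetric] intro!: card_mono)
  ultimately obtain xs where xs: "P xs" and max: "\<And>ys. P ys \<Longrightarrow> length ys \<le> length xs"
    using ex_has_greatest_nat[of P "[v]" length] by blast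
  have stuck: "u \<in> set ys" if "P ys" "length ys = length xs" "{hd ys, u} \<in> E" "u \<in> S" for ys u
  proof (rule ccontr)
    assume "u \<notin> set ys"
    then have "P (u # ys)"
      using that by (cases ys) (auto simp: P_def insert_commute)
    then show False using max that(2) by fastforce
  qed
  have rev: "P (rev xs)" using xs by (auto simp: P_def path_edges_rev)
  have len: "2 \<le> length xs"
  proof (rule ccontr)
    assume "\<not> ?thesis"
    moreover have "xs \<noteq> []" using xs by (simp add: P_def)
    ultimately obtain x where x: "xs = [x]" by (cases xs rule: path_edges.cases) auto
    then obtain u where "u \<in> S" "{x, u} \<in> E" using nbr_inside[of x] xs by (auto simp: P_def)
    then show False using stuck[OF xs] x adjacent(3) by auto
  qed
  then have "hd xs \<noteq> last xs"
    using xs by (cases xs) (auto simp: P_def)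
  moreover have "hd xs \<in> S" "last xs \<in> S" using xs by (auto simp: P_def)
  ultimately consider "nbrs E (hd xs) \<subseteq> S" | "nbrs E (hd (rev xs)) \<subseteq> S"
    using leaving_unique by (fastforce simp: nbrs_def hd_rev)
  then show ?thesis
  proof cases
    case 1
    then have "nbrs E (hd xs) \<subseteq> set xs" using stuck[OF xs] by (auto simp: nbrs_def)
    then show ?thesis using cycle_of_stuck_path[of xs] xs len by (auto simp: P_def)
  next
    case 2
    then have "nbrs E (hd (rev xs)) \<subseteq> set (rev xs)" using stuck[OF rev] by (auto simp: nbrs_def)
    then show ?thesis using cycle_of_stuck_path[of "rev xs"] rev len by (auto simp: P_def)
  qed
qed

text \<open>Take a longest cycle in \<open>S\<close> and a component \<open>D\<close> of the rest of
  \<open>S\<close> that is joined to it. By \<open>attach\<close> only one edge joins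
  \<open>D\<close> to the cycle. If an edge leaves \<open>S\<close>, it starts in \<open>D\<close>
  or in \<open>S - D\<close>, so the other of these two smaller sets is left by one edge only,
  contrary to minimality.\<close>

lemma hamiltonian_cycle: "\<exists>xs. cycle E xs \<and> set xs = S"
proof -
  define P where "P xs \<longleftrightarrow> cycle E xs \<and> set xs \<subseteq> S" for xs
  have finS: "finite S" using S(1) edge(3) finite_subset by blast
  obtain ys where "P ys" using cycle_exists by (auto simp: P_def)
  moreover have "\<forall>y. P y \<longrightarrow> length y < Suc (card S)"
    using finS by (auto simp: P_def cycle_def less_Suc_eq_le distinct_card[symmetric] intro!: card_mono)
  ultimately obtain xs where xs: "P xs" and max: "\<And>ys. P ys \<Longrightarrow> length ys \<le> length xs"
    using ex_has_greatest_nat[of P ys length] by blast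
  have "set xs = S"
  proof (rule ccontr)
    assume "set xs \<noteq> S"
    then have proper: "set xs \<subset> S" "set xs \<noteq> {}"
      using xs by (auto simp: P_def cycle_def)
    \<comment> \<open>By minimality at least two edges leave the vertex set of the cycle, and at
      most one edge leaves \<open>S\<close>.\<close>
    have "\<not> boundary E (set xs) \<subseteq> boundary E S"
    proof
      assume "boundary E (set xs) \<subseteq> boundary E S"
      then have "card (boundary E (set xs)) \<le> card (boundary E S)"
        using finite_E by (intro card_mono) (auto simp: boundary_def)
      then show False using minimal[OF proper] S(3) by simp
    qed
    then obtain e where e: "e \<in> E" "e \<inter> set xs \<noteq> {}" "\<not> e \<subseteq> set xs" "e \<subseteq> S"
      using proper by (auto simp: boundary_def)
    then obtain x d where xd: "x \<in> set xs" "{x, d} \<in> E" "d \<in> S - set xs"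
      using edge_other_end[OF graph e(1)] by fastforce
    define D where "D = {u. \<exists>us. path_between E d us u \<and> set us \<subseteq> S - set xs}"
    have dD: "d \<in> D" using xd by (auto simp: D_def path_between_def intro!: exI[of _ "[d]"])
    have DS: "D \<subseteq> S - set xs" by (auto simp: D_def path_between_def dest: last_in_set)
    have stay: "w \<in> D" if u: "u \<in> D" "{u, w} \<in> E" "w \<in> S - set xs" for u w
    proof -
      obtain us where us: "path_between E d us u" "set us \<subseteq> S - set xs"
        using u unfolding D_def by blast
      show ?thesis
      proof (cases "w \<in> set us")
        case True
        then obtain A C where AC: "us = A @ w # C" by (meson split_list)
        then have "path_between E d (A @ [w]) w"
          using us(1) path_edges_append[of A w C] by (auto simp: path_between_def hd_append)
        then show ?thesis using us(2) AC by (force simp: D_def)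
      next
        case False
        have "path_edges (butlast us @ u # [w]) = path_edges (butlast us @ [u]) \<union> path_edges [u, w]"
          by (rule path_edges_append)
        moreover have "butlast us @ [u] = us" using us(1) by (auto simp: path_between_def)
        ultimately have "path_edges (us @ [w]) = path_edges us \<union> {{u, w}}"
          by (metis append.assoc append_Cons append_Nil path_edges.simps(1) path_edges.simps(3))
        then have "path_between E d (us @ [w]) w"
          using us(1) \<open>{u, w} \<in> E\<close> False by (auto simp: path_between_def)
        then show ?thesis using us(2) \<open>w \<in> S - set xs\<close> by (force simp: D_def)
      qed
    qed
    have attach: "u = d \<and> y = x" if u: "u \<in> D" "{u, y} \<in> E" "y \<in> set xs" for u y
    proof -
      obtain us where us: "path_between E d us u" "set us \<subseteq> S - set xs"
        using u(1) unfolding D_def by blast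
      obtain P0 Q0 where "xs = P0 @ x # Q0" using xd(1) by (meson split_list)
      then have cyc: "cycle E (x # Q0 @ P0)" and set: "set (x # Q0 @ P0) = set xs"
        and len: "length (x # Q0 @ P0) = length xs"
        using xs cycle_rotate[of E P0 "x # Q0"] by (auto simp: P_def)
      obtain R where R: "cycle E (x # R)" "set (x # R) = set xs" "length (x # R) = length xs"
        using cyc set len by blast
      have R3: "2 \<le> length R" "distinct (x # R)" using R by (auto simp: cycle_def)
      show ?thesis
      proof (cases "y = x")
        case True
        \<comment> \<open>With \<open>u\<close> different from \<open>d\<close>, the vertex
          \<open>x\<close> would have four neighbours: these two and its two neighbours on the
          cycle.\<close>
        have R0: "R \<noteq> []" using R3 by auto
        have "hd R \<noteq> last R" using R3 by (cases R) auto
        moreover have "{x, hd R} \<in> E" using R(1) R0 by (cases R) (auto simp: cycle_def)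
        moreover have "{x, last R} \<in> E"
        proof -
          have "path_edges ((x # butlast R) @ last R # [x]) =
              path_edges ((x # butlast R) @ [last R]) \<union> path_edges [last R, x]"
            by (rule path_edges_append)
          then have "path_edges (x # R @ [x]) = path_edges (x # R) \<union> {{last R, x}}"
            using R0 by (metis append.assoc append_Cons append_Nil append_butlast_last_id
                path_edges.simps(1) path_edges.simps(3))
          then show ?thesis using R(1) by (auto simp: cycle_def insert_commute)
        qed
        moreover have "hd R \<in> set xs" "last R \<in> set xs"
          using R(2) R0 hd_in_set last_in_set set_subset_Cons by (metis subsetD)+
        moreover have "d \<notin> set xs" "u \<notin> set xs" using xd DS u by auto
        moreover have "{x, u} \<in> E" using u(2) True by (simp add: insert_commute)
        ultimately have "u = d" using no_four_nbrs[OF \<open>{x, d} \<in> E\<close>, of u "hd R" "last R"] by auto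
        then show ?thesis using True by simp
      next
        case False
        then have "y \<in> set R" using u(3) R(2) by auto
        then obtain A C where AC: "R = A @ y # C" by (meson split_list)
        have dist: "distinct (x # A @ y # C)" using R3(2) AC by simp
        have us_ne: "us \<noteq> []" using us(1) by (simp add: path_between_def)
        have eds: "path_edges (x # us @ [y]) = {{x, d}} \<union> path_edges us \<union> {{u, y}}"
        proof -
          have us': "butlast us @ [u] = us" using us(1) by (auto simp: path_between_def)
          have "path_edges ((x # butlast us) @ u # [y]) =
              path_edges ((x # butlast us) @ [u]) \<union> path_edges [u, y]"
            by (rule path_edges_append)
          then have "path_edges (x # us @ [y]) = path_edges (x # us) \<union> {{u, y}}"
            using us' by (metis append.assoc append_Cons append_Nil path_edges.simps(1) path_edges.simps(3))
          moreover have "path_edges (x # us) = insert {x, d} (path_edges us)"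
            using us(1) us_ne by (cases us) (auto simp: path_between_def)
          ultimately show ?thesis by auto
        qed
        have ear: "path_between E x (x # us @ [y]) y"
          using us xd u(2,3) False eds by (auto simp: path_between_def)
        have off: "set us \<inter> set (x # A @ y # C) = {}" using us(2) R(2) AC by auto
        have split: "path_edges (x # A @ y # C @ [x]) = path_edges (x # A @ [y]) \<union> path_edges (y # C @ [x])"
          using path_edges_append[of "x # A" y "C @ [x]"] by simp
        have inS: "set us \<subseteq> S" "set (x # A @ y # C) \<subseteq> S" using us(2) R(2) AC proper by auto
        \<comment> \<open>If \<open>y\<close> follows \<open>x\<close> on the cycle, replacing the
          edge \<open>xy\<close> by the path through \<open>us\<close> gives a longer cycle.\<close>
        have "A \<noteq> []"
        proof
          assume "A = []"
          have "path_edges ((x # us) @ y # C @ [x]) = path_edges ((x # us) @ [y]) \<union> path_edges (y # C @ [x])"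
            by (rule path_edges_append)
          then have "cycle E (x # us @ y # C)"
            using R(1) AC split ear dist off us(1) us_ne R3(1) \<open>A = []\<close>
            by (cases us) (auto simp: cycle_def path_between_def)
          then show False
            using max[of "x # us @ y # C"] inS R(3) AC \<open>A = []\<close> us_ne by (cases us) (auto simp: P_def)
        qed
        \<comment> \<open>If \<open>y\<close> is last, the closing edge \<open>yx\<close> is the one
          replaced, so \<open>us\<close> is passed backwards. In the remaining case the path is an
          ear at vertices that are not neighbours on the cycle.\<close>
        moreover have "C \<noteq> []"
        proof
          assume "C = []"
          have "path_edges ((x # A) @ y # rev us @ [x]) = path_edges ((x # A) @ [y]) \<union> path_edges (y # rev us @ [x])"
            by (rule path_edges_append)
          moreover have "path_edges (y # rev us @ [x]) = path_edges (x # us @ [y])"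
            using path_edges_rev[of "x # us @ [y]"] by simp
          ultimately have "cycle E (x # A @ y # rev us)"
            using R(1) AC split ear dist off us(1) us_ne R3(1) \<open>C = []\<close>
            by (cases us) (auto simp: cycle_def path_between_def)
          then show False
            using max[of "x # A @ y # rev us"] inS R(3) AC \<open>C = []\<close> us_ne by (cases us) (auto simp: P_def)
        qed
        ultimately show ?thesis using no_cycle_ear[OF _ _ _ ear us_ne off] R(1) AC by simp
      qed
    qed
    have bD: "boundary E D \<subseteq> insert {x, d} {e \<in> boundary E S. e \<inter> D \<noteq> {}}"
    proof
      fix e assume "e \<in> boundary E D"
      then obtain u w where e: "e = {u, w}" "e \<in> E" "u \<in> D" "w \<notin> D"
        using edge_other_end[OF graph] unfolding boundary_def by fastforce
      show "e \<in> insert {x, d} {e \<in> boundary E S. e \<inter> D \<noteq> {}}"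
      proof (cases "w \<in> S")
        case True
        then have "w \<in> set xs" using stay[of u w] e by blast
        then show ?thesis using attach[of u w] e by auto
      next
        case False
        then show ?thesis using e DS by (auto simp: boundary_def)
      qed
    qed
    have bSD: "boundary E (S - D) \<subseteq> insert {x, d} {e \<in> boundary E S. e \<inter> D = {}}"
    proof
      fix e assume "e \<in> boundary E (S - D)"
      then obtain u w where e: "e = {u, w}" "e \<in> E" "u \<in> S - D" "w \<notin> S - D"
        using edge_other_end[OF graph] unfolding boundary_def by fastforce
      show "e \<in> insert {x, d} {e \<in> boundary E S. e \<inter> D = {}}"
      proof (cases "w \<in> D")
        case True
        then have "u \<in> set xs" using stay[of w u] e by (auto simp: insert_commute)
        then show ?thesis using attach[of w u] e True by (auto simp: insert_commute)
      next
        case False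
        then show ?thesis using e by (auto simp: boundary_def)
      qed
    qed
    have D: "D \<subset> S" "D \<noteq> {}" "S - D \<subset> S" "S - D \<noteq> {}"
      using dD DS proper xd(1) by blast+
    \<comment> \<open>At most one edge leaves \<open>S\<close>, so it cannot burden both
      \<open>D\<close> and \<open>S - D\<close>.\<close>
    have "(\<forall>e\<in>boundary E S. e \<inter> D \<noteq> {}) \<or> (\<forall>e\<in>boundary E S. e \<inter> D = {})"
      using boundary_unique by metis
    then consider "boundary E D \<subseteq> {{x, d}}" | "boundary E (S - D) \<subseteq> {{x, d}}"
      using bD bSD by blast
    then show False
    proof cases
      case 1
      then have "card (boundary E D) \<le> 1" using card_mono[OF _ 1] by simp
      then show False using minimal[OF D(1,2)] by simp
    next
      case 2
      then have "card (boundary E (S - D)) \<le> 1" using card_mono[OF _ 2] by simp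
      then show False using minimal[OF D(3,4)] by simp
    qed
  qed
  then show ?thesis using xs by (auto simp: P_def)
qed

text \<open>The vertex that may have an edge leaving \<open>S\<close> is rotated to position 0,
  which never lies strictly between the ends of a chord.\<close>

lemma hamiltonian_cycle_inner: "\<exists>xs. cycle E xs \<and> set xs = S \<and> (\<forall>i. 0 < i \<longrightarrow> i < length xs \<longrightarrow> nbrs E (xs ! i) \<subseteq> S)"
proof -
  obtain xs where xs: "cycle E xs" "set xs = S" using hamiltonian_cycle by blast
  show ?thesis
  proof (cases "\<exists>v\<in>S. \<not> nbrs E v \<subseteq> S")
    case True
    then obtain v where v: "v \<in> S" "\<not> nbrs E v \<subseteq> S" by blast
    then obtain P Q where PQ: "xs = P @ v # Q" using xs(2) by (metis split_list)
    let ?ys = "v # Q @ P"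
    have ys: "cycle E ?ys" "set ?ys = S" using xs PQ cycle_rotate[of E P "v # Q"] by auto
    have "nbrs E (?ys ! i) \<subseteq> S" if i: "0 < i" "i < length ?ys" for i
    proof -
      have "distinct ?ys" using ys(1) by (simp add: cycle_def)
      then have "?ys ! i \<noteq> ?ys ! 0" by (subst nth_eq_iff_index_eq) (use i in auto)
      then have "?ys ! i \<noteq> v" by simp
      moreover have "?ys ! i \<in> S" using ys(2) i nth_mem by blast
      ultimately show ?thesis using v leaving_unique by (fastforce simp: nbrs_def)
    qed
    then show ?thesis using ys by blast
  next
    case False
    then show ?thesis using xs nth_mem by blast
  qed
qed

text \<open>The length of a chord is the distance of its positions in the list. An additional edge
  at a vertex strictly between \<open>i\<close> and \<open>j\<close> either crosses the chord or has
  both ends within the positions \<open>i\<close> to \<open>j\<close> and is a shorter chord. Its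
  other end cannot lie off the cycle, by the choice of position 0.\<close>

lemma shortest_chord:
  obtains xs i j where "cycle E xs" "set xs \<subseteq> V" "i + 2 \<le> j" "j < length xs" "{xs ! i, xs ! j} \<in> E"
    "\<And>k. i < k \<Longrightarrow> k < j \<Longrightarrow> nbrs E (xs ! k) \<subseteq> {xs ! (k - 1), xs ! Suc k}"
proof -
  obtain xs where xs: "cycle E xs" "set xs = S"
    and inner: "\<And>i. 0 < i \<Longrightarrow> i < length xs \<Longrightarrow> nbrs E (xs ! i) \<subseteq> S"
    using hamiltonian_cycle_inner by blast
  define P where "P ij \<longleftrightarrow> fst ij + 2 \<le> snd ij \<and> snd ij < length xs \<and> {xs ! fst ij, xs ! snd ij} \<in> E" for ij
  \<comment> \<open>The closing edge counts as a chord, so a chord always exists. Its ends have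
    distance at least 2 because a cycle has at least three vertices.\<close>
  have "P (0, length xs - 1)"
    using xs(1) cycle_edges(2)[OF xs(1)] by (auto simp: P_def cycle_def)
  then obtain ij where "P ij" and least: "\<And>ij'. P ij' \<Longrightarrow> snd ij - fst ij \<le> snd ij' - fst ij'"
    using ex_has_least_nat[of P _ "\<lambda>ij. snd ij - fst ij"] by blast
  then obtain i j where ij: "i + 2 \<le> j" "j < length xs" "{xs ! i, xs ! j} \<in> E"
    and least: "\<And>i' j'. i' + 2 \<le> j' \<Longrightarrow> j' < length xs \<Longrightarrow> {xs ! i', xs ! j'} \<in> E \<Longrightarrow> j - i \<le> j' - i'"
    unfolding P_def by (cases ij) fastforce
  have "nbrs E (xs ! k) \<subseteq> {xs ! (k - 1), xs ! Suc k}" if k: "i < k" "k < j" for k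
  proof
    fix u assume u: "u \<in> nbrs E (xs ! k)"
    then have "u \<in> S" using inner[of k] k ij by auto
    then obtain l where l: "u = xs ! l" "l < length xs" using xs(2) by (metis in_set_conv_nth)
    have e: "{xs ! k, xs ! l} \<in> E" "{xs ! l, xs ! k} \<in> E" using u l by (auto simp: nbrs_def insert_commute)
    have "l \<noteq> k" using adjacent(3)[OF e(1)] by auto
    have "\<not> l < i" using no_cycle_crossing_nth[OF xs(1) _ k _ e(2) ij(3)] ij by blast
    moreover have "\<not> j < l" using no_cycle_crossing_nth[OF xs(1) k _ l(2) ij(3) e(1)] by blast
    ultimately have "i \<le> l" "l \<le> j" by auto
    have "l = k - 1 \<or> l = Suc k"
    proof (rule ccontr)
      assume no: "\<not> ?thesis"
      show False
      proof (cases "l < k")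
        case True
        then have "l + 2 \<le> k" using no by linarith
        then have "j - i \<le> k - l" using least[of l k] e(2) k ij by simp
        then show False using \<open>i \<le> l\<close> \<open>l < k\<close> k by linarith
      next
        case False
        then have "k + 2 \<le> l" using no \<open>l \<noteq> k\<close> by linarith
        then have "j - i \<le> l - k" using least[of k l] e(1) l(2) by simp
        then show False using \<open>l \<le> j\<close> \<open>k + 2 \<le> l\<close> k by linarith
      qed
    qed
    then show "u \<in> {xs ! (k - 1), xs ! Suc k}" using l(1) by blast
  qed
  then show ?thesis using that xs S(1) ij by blast
qed

end

section \<open>Existence of a triangle or a thread\<close>

context small_degree
begin

lemma end_block_exists:
  assumes "V \<noteq> {}"
  shows "\<exists>S. end_block V E p c F S"
proof -
  define P where "P S \<longleftrightarrow> S \<subseteq> V \<and> S \<noteq> {} \<and> card (boundary E S) \<le> 1" for S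
  have "boundary E V = {}" using edge(1) by (auto simp: boundary_def)
  then have "P V" using assms by (simp add: P_def)
  then obtain S where S: "P S" and least: "\<And>T. P T \<Longrightarrow> card S \<le> card T"
    using ex_has_least_nat[of P V card] by blast
  have "1 < card (boundary E T)" if T: "T \<subset> S" "T \<noteq> {}" for T
  proof (rule ccontr)
    assume "\<not> ?thesis"
    then have "P T" using T S by (auto simp: P_def)
    moreover have "finite S" using S edge(3) finite_subset by (auto simp: P_def)
    ultimately show False using least[of T] psubset_card_mono[OF _ T(1)] by simp
  qed
  then show ?thesis
    using S by (intro exI[of _ S] end_block.intro small_degree_axioms end_block_axioms.intro) (auto simp: P_def)
qed

text \<open>If the shortest chord skips one vertex, it closes a triangle. If it skips more, the
  first two skipped vertices are adjacent and both have degree 2.\<close>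

lemma triangle_or_thread:
  assumes "V \<noteq> {}"
  shows "(\<exists>x y z. distinct [x, y, z] \<and> {x, y} \<in> E \<and> {x, z} \<in> E \<and> {y, z} \<in> E \<and> degree E z = 2) \<or>
    (\<exists>x u v y. distinct [x, u, v, y] \<and> {x, u} \<in> E \<and> {u, v} \<in> E \<and> {v, y} \<in> E \<and>
      degree E u = 2 \<and> degree E v = 2)"
proof -
  obtain S where "end_block V E p c F S" using end_block_exists[OF assms] by blast
  then interpret end_block V E p c F S .
  obtain xs i j where xs: "cycle E xs" "set xs \<subseteq> V" and ij: "i + 2 \<le> j" "j < length xs" "{xs ! i, xs ! j} \<in> E"
    and inner: "\<And>k. i < k \<Longrightarrow> k < j \<Longrightarrow> nbrs E (xs ! k) \<subseteq> {xs ! (k - 1), xs ! Suc k}"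
    using shortest_chord by blast
  have dist: "distinct xs" using xs(1) by (simp add: cycle_def)
  have deg: "degree E (xs ! k) = 2" if "i < k" "k < j" for k
  proof -
    have "xs ! k \<in> set xs" using that(2) ij(2) by simp
    then show ?thesis using degree_two[OF _ inner[OF that]] xs(2) by blast
  qed
  note edges = cycle_edges(1)[OF xs(1)]
  show ?thesis
  proof (cases "j = i + 2")
    case True
    then show ?thesis
      using ij deg[of "Suc i"] edges[of i] edges[of "Suc i"] dist
      by (intro disjI1 exI[of _ "xs ! i"] exI[of _ "xs ! j"] exI[of _ "xs ! Suc i"])
        (auto simp: nth_eq_iff_index_eq insert_commute)
  next
    case False
    then show ?thesis
      using ij deg[of "Suc i"] deg[of "i + 2"] edges[of i] edges[of "Suc i"] edges[of "i + 2"] dist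
      by (intro disjI2 exI[of _ "xs ! i"] exI[of _ "xs ! Suc i"] exI[of _ "xs ! (i + 2)"] exI[of _ "xs ! (i + 3)"])
        (auto simp: nth_eq_iff_index_eq numeral_eq_Suc)
  qed
qed

end

section \<open>Labels around small configurations\<close>

definition far :: "nat \<Rightarrow> nat \<Rightarrow> bool" where "far a b \<longleftrightarrow> a + 2 \<le> b \<or> b + 2 \<le> a"
text \<open>An explicit list, so that \<open>code_simp\<close> can unfold the bounded quantifiers
  below.\<close>

definition labels :: "nat set" where "labels = {0,1,2,3,4,5}"
text \<open>In the following lemmas \<open>a\<close>, \<open>b\<close> are the labels of the vertices to which a configuration is
  attached and \<open>e\<close>, \<open>e'\<close> those of the attaching edges. The premise of \<open>label_quad\<close> and
  \<open>label_capped_quad\<close> excludes the six pairs \<open>(a, e)\<close>, \<open>(b, e')\<close> between which no edge with its ends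
  can be labelled. Each quantifier is followed at once by its constraints, so that evaluation
  prunes the search.\<close>

lemma label_thread: "\<forall>a\<in>labels. \<forall>e\<in>labels. far a e \<longrightarrow> (\<forall>b\<in>labels. far b e \<longrightarrow> a \<noteq> b \<longrightarrow>
  (\<exists>c\<in>labels. c \<noteq> a \<and> far c e \<and> (\<exists>m\<in>labels. m \<noteq> e \<and> far c m \<and>
  (\<exists>d\<in>labels. d \<noteq> b \<and> d \<noteq> c \<and> far d e \<and> far d m))))"
  unfolding labels_def by code_simp
lemma label_quad: "\<forall>a\<in>labels. \<forall>e\<in>labels. far a e \<longrightarrow> (\<forall>b\<in>labels. \<forall>e'\<in>labels. far b e' \<longrightarrow>
  (\<exists>x\<in>labels. x \<noteq> a \<and> far x e \<and> (\<exists>m\<in>labels. m \<noteq> e \<and> m \<noteq> e' \<and> far x m \<and>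
  (\<exists>y\<in>labels. y \<noteq> b \<and> y \<noteq> x \<and> far y e' \<and> far y m))) \<longrightarrow>
  (\<exists>x\<in>labels. x \<noteq> a \<and> far x e \<and> (\<exists>m\<in>labels. m \<noteq> e \<and> m \<noteq> e' \<and> far x m \<and>
  (\<exists>y\<in>labels. y \<noteq> b \<and> y \<noteq> x \<and> far y e' \<and> far y m \<and>
  (\<exists>i\<in>labels. i \<noteq> e \<and> i \<noteq> m \<and> far x i \<and> (\<exists>u\<in>labels. u \<noteq> x \<and> far u i \<and>
  (\<exists>j\<in>labels. j \<noteq> e' \<and> j \<noteq> m \<and> far y j \<and> (\<exists>w\<in>labels. w \<noteq> u \<and> w \<noteq> y \<and> far w j \<and>
  (\<exists>k\<in>labels. k \<noteq> i \<and> k \<noteq> j \<and> far u k \<and> far w k)))))))))"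
  unfolding labels_def by code_simp
lemma label_pendant_triangle: "\<forall>a\<in>labels. \<forall>e\<in>labels. far a e \<longrightarrow>
  (\<exists>x\<in>labels. x \<noteq> a \<and> far x e \<and> (\<exists>m\<in>labels. m \<noteq> e \<and> far x m \<and>
  (\<exists>y\<in>labels. y \<noteq> x \<and> far y m \<and>
  (\<exists>i\<in>labels. i \<noteq> e \<and> i \<noteq> m \<and> far x i \<and> (\<exists>z\<in>labels. z \<noteq> x \<and> z \<noteq> y \<and> far z i \<and>
  (\<exists>j\<in>labels. j \<noteq> m \<and> j \<noteq> i \<and> far y j \<and> far z j))))))"
  unfolding labels_def by code_simp
text \<open>\<open>w\<close> is the common neighbour of \<open>x\<close> and \<open>y\<close>
  outside the triangle, and \<open>k\<close>, \<open>l\<close> label its edges to them. As in the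
  other triangle lemmas, \<open>m\<close>, \<open>i\<close>, \<open>j\<close> label the edges
  \<open>xy\<close>, \<open>xz\<close>, \<open>yz\<close>.\<close>

lemma label_pendant_diamond: "\<forall>a\<in>labels. \<forall>e\<in>labels. far a e \<longrightarrow>
  (\<exists>w\<in>labels. w \<noteq> a \<and> far w e \<and> (\<exists>k\<in>labels. k \<noteq> e \<and> far w k \<and> (\<exists>l\<in>labels. l \<noteq> e \<and> l \<noteq> k \<and> far w l \<and>
  (\<exists>x\<in>labels. x \<noteq> w \<and> far x k \<and> (\<exists>m\<in>labels. m \<noteq> k \<and> m \<noteq> l \<and> far x m \<and>
  (\<exists>y\<in>labels. y \<noteq> w \<and> y \<noteq> x \<and> far y l \<and> far y m \<and>
  (\<exists>i\<in>labels. i \<noteq> k \<and> i \<noteq> m \<and> far x i \<and> (\<exists>z\<in>labels. z \<noteq> x \<and> z \<noteq> y \<and> far z i \<and>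
  (\<exists>j\<in>labels. j \<noteq> l \<and> j \<noteq> m \<and> j \<noteq> i \<and> far y j \<and> far z j)))))))))"
  unfolding labels_def by code_simp
lemma label_triangle: "\<forall>a\<in>labels. \<forall>e\<in>labels. far a e \<longrightarrow> (\<forall>b\<in>labels. far b e \<longrightarrow> a \<noteq> b \<longrightarrow>
  (\<exists>x\<in>labels. x \<noteq> a \<and> far x e \<and> (\<exists>m\<in>labels. m \<noteq> e \<and> far x m \<and>
  (\<exists>y\<in>labels. y \<noteq> b \<and> y \<noteq> x \<and> far y e \<and> far y m \<and>
  (\<exists>i\<in>labels. i \<noteq> e \<and> i \<noteq> m \<and> far x i \<and> (\<exists>z\<in>labels. z \<noteq> x \<and> z \<noteq> y \<and> far z i \<and>
  (\<exists>j\<in>labels. j \<noteq> e \<and> j \<noteq> m \<and> j \<noteq> i \<and> far y j \<and> far z j)))))))"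
  unfolding labels_def by code_simp
lemma label_capped_quad: "\<forall>a\<in>labels. \<forall>e\<in>labels. far a e \<longrightarrow> (\<forall>b\<in>labels. \<forall>e'\<in>labels. far b e' \<longrightarrow>
  (\<exists>x\<in>labels. x \<noteq> a \<and> far x e \<and> (\<exists>m\<in>labels. m \<noteq> e \<and> m \<noteq> e' \<and> far x m \<and>
  (\<exists>y\<in>labels. y \<noteq> b \<and> y \<noteq> x \<and> far y e' \<and> far y m))) \<longrightarrow>
  (\<exists>v\<in>labels. v \<noteq> a \<and> far v e \<and> (\<exists>n\<in>labels. n \<noteq> e \<and> n \<noteq> e' \<and> far v n \<and>
  (\<exists>w\<in>labels. w \<noteq> b \<and> w \<noteq> v \<and> far w e' \<and> far w n \<and>
  (\<exists>k\<in>labels. k \<noteq> e \<and> k \<noteq> n \<and> far v k \<and> (\<exists>l\<in>labels. l \<noteq> e' \<and> l \<noteq> n \<and> far w l \<and>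
  (\<exists>x\<in>labels. x \<noteq> v \<and> far x k \<and> (\<exists>m\<in>labels. m \<noteq> k \<and> m \<noteq> l \<and> far x m \<and>
  (\<exists>y\<in>labels. y \<noteq> w \<and> y \<noteq> x \<and> far y l \<and> far y m \<and>
  (\<exists>i\<in>labels. i \<noteq> k \<and> i \<noteq> m \<and> far x i \<and> (\<exists>z\<in>labels. z \<noteq> x \<and> z \<noteq> y \<and> far z i \<and>
  (\<exists>j\<in>labels. j \<noteq> l \<and> j \<noteq> m \<and> j \<noteq> i \<and> far y j \<and> far z j))))))))))))"
  unfolding labels_def by code_simp

text \<open>A vertex label rules out at most three of the six labels for the edges at that vertex.
  With one label fewer this would fail, for example at label 1.\<close>

lemma label_three: "\<forall>a\<in>labels. \<exists>e1\<in>labels. far a e1 \<and> (\<exists>e2\<in>labels. e2 \<noteq> e1 \<and> far a e2 \<and>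
  (\<exists>e3\<in>labels. e3 \<noteq> e1 \<and> e3 \<noteq> e2 \<and> far a e3))"
  unfolding labels_def by code_simp
lemma label_leaf: "\<forall>a\<in>labels. \<forall>e\<in>labels. \<exists>x\<in>labels. x \<noteq> a \<and> far x e"
  unfolding labels_def by code_simp
text \<open>Labels for the fictitious third neighbour in \<open>stub\<close> and the edge leading to
  it.\<close>

lemma label_stub: "\<forall>x\<in>labels. \<forall>m\<in>labels. \<exists>e\<in>labels. e \<noteq> m \<and> far x e \<and> (\<exists>a\<in>labels. a \<noteq> x \<and> far a e)"
  unfolding labels_def by code_simp

section \<open>Reducible configurations\<close>

text \<open>Edges enter as \<open>{v, u}\<close> with \<open>v\<close> and \<open>u\<close> ranging
  freely, so each condition is seen from an end of an edge and can be checked vertex by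
  vertex.\<close>

definition labelling :: "'a set \<Rightarrow> 'a set set \<Rightarrow> ('a \<Rightarrow> nat) \<Rightarrow> ('a set \<Rightarrow> nat) \<Rightarrow> bool" where
  "labelling V E g h \<longleftrightarrow> (\<forall>v\<in>V. g v \<in> labels) \<and> (\<forall>e\<in>E. h e \<in> labels) \<and>
     (\<forall>v u. {v, u} \<in> E \<longrightarrow> g v \<noteq> g u \<and> far (g v) (h {v, u})) \<and>
     (\<forall>v u w. {v, u} \<in> E \<longrightarrow> {v, w} \<in> E \<longrightarrow> u \<noteq> w \<longrightarrow> h {v, u} \<noteq> h {v, w})"

lemma labellingD:
  assumes "labelling V E g h"
  shows "v \<in> V \<Longrightarrow> g v \<in> labels" "e \<in> E \<Longrightarrow> h e \<in> labels"
    "{v, u} \<in> E \<Longrightarrow> g v \<noteq> g u" "{v, u} \<in> E \<Longrightarrow> far (g v) (h {v, u})" "{v, u} \<in> E \<Longrightarrow> far (g u) (h {v, u})"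
    "{v, u} \<in> E \<Longrightarrow> {v, w} \<in> E \<Longrightarrow> u \<noteq> w \<Longrightarrow> h {v, u} \<noteq> h {v, w}"
proof -
  have "\<forall>v u. {v, u} \<in> E \<longrightarrow> g v \<noteq> g u \<and> far (g v) (h {v, u})"
    using assms unfolding labelling_def by simp
  then show "{v, u} \<in> E \<Longrightarrow> g v \<noteq> g u" "{v, u} \<in> E \<Longrightarrow> far (g v) (h {v, u})" "{v, u} \<in> E \<Longrightarrow> far (g u) (h {v, u})"
    by (metis insert_commute)+
qed (use assms in \<open>simp_all add: labelling_def\<close>)

text \<open>\<open>X\<close> and \<open>N\<close> collect the vertices and edges with new labels.
  Conditions are checked at \<open>X\<close> and at the ends of \<open>N\<close> outside
  \<open>X\<close>, and the others are inherited. \<open>E'\<close> may exceed \<open>E\<close>,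
  since the joining edge of \<open>shortcut\<close> disappears again. An edge of \<open>N\<close>
  has an end in \<open>X\<close>, where its ends are compared.\<close>

lemma relabel:
  assumes old: "labelling W E' g h"
    and V: "V \<subseteq> W \<union> X" "\<And>v. v \<notin> X \<Longrightarrow> g' v = g v"
    and E: "E \<subseteq> E' \<union> N" "\<And>e. e \<in> E \<Longrightarrow> e \<notin> N \<Longrightarrow> h' e = h e"
    and labels: "\<And>v. v \<in> X \<Longrightarrow> g' v \<in> labels" "\<And>e. e \<in> N \<Longrightarrow> h' e \<in> labels"
    and X: "\<And>v u. v \<in> X \<Longrightarrow> {v, u} \<in> E \<Longrightarrow> g' v \<noteq> g' u \<and> far (g' v) (h' {v, u})"
      "\<And>v u w. v \<in> X \<Longrightarrow> {v, u} \<in> E \<Longrightarrow> {v, w} \<in> E \<Longrightarrow> u \<noteq> w \<Longrightarrow> h' {v, u} \<noteq> h' {v, w}"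
    and N: "\<And>v u. v \<notin> X \<Longrightarrow> {v, u} \<in> N \<Longrightarrow> {v, u} \<in> E \<Longrightarrow> u \<in> X \<and> far (g' v) (h' {v, u})"
      "\<And>v u w. v \<notin> X \<Longrightarrow> {v, u} \<in> N \<Longrightarrow> {v, u} \<in> E \<Longrightarrow> {v, w} \<in> E \<Longrightarrow> u \<noteq> w \<Longrightarrow> h' {v, u} \<noteq> h' {v, w}"
  shows "labelling V E g' h'"
  unfolding labelling_def
proof (intro conjI ballI allI impI)
  note old = labellingD[OF old]
  fix v assume "v \<in> V"
  then show "g' v \<in> labels" using V labels(1) old(1) by (cases "v \<in> X") auto
next
  note old = labellingD[OF old]
  fix e assume "e \<in> E"
  then show "h' e \<in> labels" using E labels(2) old(2) by (cases "e \<in> N") auto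
next
  note old = labellingD[OF old]
  fix v u assume e: "{v, u} \<in> E"
  show "far (g' v) (h' {v, u})"
  proof (cases "v \<in> X")
    case False
    show ?thesis
    proof (cases "{v, u} \<in> N")
      case False
      then show ?thesis using \<open>v \<notin> X\<close> E V(2) old(4) e by fastforce
    qed (use N(1) e False in blast)
  qed (use X(1) e in blast)
  show "g' v \<noteq> g' u"
  proof (cases "v \<in> X")
    case v: False
    show ?thesis
    proof (cases "u \<in> X")
      case True
      then show ?thesis using X(1)[OF True, of v] e by (simp add: insert_commute)
    next
      case False
      then have "{v, u} \<notin> N" using N(1) v e by blast
      then show ?thesis using v False E(1) V(2) old(3) e by auto
    qed
  qed (use X(1) e in blast)
next
  note old = labellingD[OF old]
  fix v u w assume e: "{v, u} \<in> E" "{v, w} \<in> E" "u \<noteq> w"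
  show "h' {v, u} \<noteq> h' {v, w}"
  proof (cases "v \<in> X")
    case False
    consider "{v, u} \<in> N" | "{v, w} \<in> N" | "{v, u} \<notin> N" "{v, w} \<notin> N" by blast
    then show ?thesis
    proof cases
      case 1
      then show ?thesis using N(2)[OF False 1] e by blast
    next
      case 2
      then show ?thesis using N(2)[OF False 2] e by metis
    next
      case 3
      then show ?thesis using E e old(6)[of v u w] by auto
    qed
  qed (use X(2) e in blast)
qed

text \<open>For the gadgets in which the attaching vertices are relabelled as well: all new edge
  labels stay within \<open>X\<close>, and nothing changes at the other vertices.\<close>

lemma relabel_inside:
  assumes "labelling W {e \<in> E. e \<subseteq> W} g h" "V \<subseteq> W \<union> X" "\<And>v. v \<notin> X \<Longrightarrow> g' v = g v"
    "\<And>e. e \<in> E \<Longrightarrow> e \<notin> N \<Longrightarrow> e \<subseteq> W" "\<And>e. e \<notin> N \<Longrightarrow> h' e = h e"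
    "\<And>v. v \<in> X \<Longrightarrow> g' v \<in> labels" "\<And>e. e \<in> N \<Longrightarrow> e \<subseteq> X" "\<And>e. e \<in> N \<Longrightarrow> h' e \<in> labels"
    "\<And>v u. v \<in> X \<Longrightarrow> {v, u} \<in> E \<Longrightarrow> g' v \<noteq> g' u \<and> far (g' v) (h' {v, u})"
    "\<And>v u w. v \<in> X \<Longrightarrow> {v, u} \<in> E \<Longrightarrow> {v, w} \<in> E \<Longrightarrow> u \<noteq> w \<Longrightarrow> h' {v, u} \<noteq> h' {v, w}"
  shows "labelling V E g' h'"
proof (rule relabel[OF assms(1-3), where N = N])
  show "E \<subseteq> {e \<in> E. e \<subseteq> W} \<union> N" using assms(4) by auto
  fix v u assume "v \<notin> X" "{v, u} \<in> N"
  then have False using assms(7)[of "{v, u}"] by auto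
  then show "u \<in> X \<and> far (g' v) (h' {v, u})" "\<And>w. h' {v, u} \<noteq> h' {v, w}" by simp_all
qed (simp_all add: assms)

text \<open>Peels off one update at a time. In the largest gadget this spares comparing all vertices
  and edges with each other.\<close>

lemma fun_upd_in: "y \<in> A \<Longrightarrow> (z \<noteq> x \<Longrightarrow> f z \<in> A) \<Longrightarrow> (f(x := y)) z \<in> A"
  by simp

lemma inj_at_two:
  assumes "\<And>w. {v, w} \<in> E \<Longrightarrow> w = s \<or> w = t" "h {v, s} = i" "h {v, t} = j" "i \<noteq> j"
    and "{v, u} \<in> E" "{v, w} \<in> E" "u \<noteq> w"
  shows "h {v, u} \<noteq> h {v, w}"
  using assms(1)[OF assms(5)] assms(1)[OF assms(6)] assms(2-4,7) by metis

lemma inj_at_three: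
  assumes "\<And>w. {v, w} \<in> E \<Longrightarrow> w = s \<or> w = t \<or> w = r" "h {v, s} = i" "h {v, t} = j" "h {v, r} = k"
    and "i \<noteq> j" "i \<noteq> k" "j \<noteq> k" "{v, u} \<in> E" "{v, w} \<in> E" "u \<noteq> w"
  shows "h {v, u} \<noteq> h {v, w}"
  using assms(1)[OF assms(8)] assms(1)[OF assms(9)] assms(2-7,10) by metis

context subcubic
begin

lemma nbrs_of_degree_two:
  assumes "degree E z = 2" "{z, x} \<in> E" "{z, y} \<in> E" "x \<noteq> y" "{z, u} \<in> E"
  shows "u = x \<or> u = y"
proof -
  have "card {x, y, u} \<le> card (nbrs E z)"
    using assms finite_nbrs by (intro card_mono) (auto simp: nbrs_def)
  then show ?thesis using assms(1,4) degree_eq_card_nbrs[OF graph, of z] by (auto simp: card_insert_if split: if_splits)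
qed

lemma third_unique:
  assumes "{v, s} \<in> E" "{v, t} \<in> E" "s \<noteq> t" "{v, u} \<in> E" "u \<noteq> s" "u \<noteq> t" "{v, w} \<in> E" "w \<noteq> s" "w \<noteq> t"
  shows "u = w"
  using no_four_nbrs[OF assms(1,2,4,7)] assms by auto

text \<open>\<open>v\<close> has at most one neighbour besides \<open>s\<close> and
  \<open>t\<close>, by \<open>third_unique\<close>. So the label \<open>e\<close> can describe its
  edge without naming that neighbour, and \<open>P\<close> carries along what else is known about
  it.\<close>

lemma inj_at_stub:
  assumes "{v, s} \<in> E" "{v, t} \<in> E" "s \<noteq> t"
    and "\<And>w. {v, w} \<in> E \<Longrightarrow> w = s \<or> w = t \<or> (P w \<and> h {v, w} = e)"
    and "h {v, s} = i" "h {v, t} = j" "i \<noteq> j" "i \<noteq> e" "j \<noteq> e"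
    and "{v, u} \<in> E" "{v, w} \<in> E" "u \<noteq> w"
  shows "h {v, u} \<noteq> h {v, w}"
proof -
  consider "u = s" "w = t" | "u = t" "w = s" | "u = s" "h {v, w} = e" | "u = t" "h {v, w} = e"
    | "w = s" "h {v, u} = e" | "w = t" "h {v, u} = e" | "u \<noteq> s" "u \<noteq> t" "w \<noteq> s" "w \<noteq> t"
    using assms(4)[OF assms(10)] assms(4)[OF assms(11)] assms(12) by blast
  then show ?thesis
    by cases (use assms third_unique[OF assms(1-3,10) _ _ assms(11)] in auto)
qed

text \<open>If \<open>v\<close> has no third neighbour, a fictitious one is labelled instead, so that
  the gadgets below need not distinguish the two cases.\<close>

lemma stub:
  assumes lab: "labelling W {e \<in> E. e \<subseteq> W} g h" and v: "v \<in> W"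
    and nb: "{v, s} \<in> E" "{v, t} \<in> E" "s \<noteq> t" and W: "\<And>u. {v, u} \<in> E \<Longrightarrow> u \<noteq> s \<Longrightarrow> u \<noteq> t \<Longrightarrow> u \<in> W"
    and m: "m \<in> labels"
  obtains a e where "a \<in> labels" "e \<in> labels" "far a e" "g v \<noteq> a" "far (g v) e"
    "\<And>u. {v, u} \<in> E \<Longrightarrow> u = s \<or> u = t \<or> (g u = a \<and> h {v, u} = e)"
    "(\<And>u. {v, u} \<in> E \<Longrightarrow> u \<noteq> s \<Longrightarrow> u \<noteq> t \<Longrightarrow> h {v, u} \<noteq> m) \<Longrightarrow> e \<noteq> m"
proof (cases "\<exists>u. {v, u} \<in> E \<and> u \<noteq> s \<and> u \<noteq> t")
  case True
  then obtain u where u: "{v, u} \<in> E" "u \<noteq> s" "u \<noteq> t" by blast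
  have uW: "u \<in> W" "{v, u} \<in> {e \<in> E. e \<subseteq> W}" using W u v by auto
  show ?thesis
  proof (rule that[of "g u" "h {v, u}"])
    show "w = s \<or> w = t \<or> (g w = g u \<and> h {v, w} = h {v, u})" if "{v, w} \<in> E" for w
      using third_unique[OF nb u that] by blast
  qed (use labellingD[OF lab] uW u in auto)
next
  case False
  \<comment> \<open>The premise of the last clause holds vacuously here, so \<open>e\<close> has to
    be chosen different from \<open>m\<close>.\<close>
  obtain a e where "e \<in> labels" "e \<noteq> m" "far (g v) e" "a \<in> labels" "a \<noteq> g v" "far a e"
    using label_stub labellingD(1)[OF lab v] m by blast
  then show ?thesis using that[of a e] False by blast
qed

end

text \<open>\<open>smaller\<close> is the induction hypothesis. \<open>p\<close> and
  \<open>F\<close> stay the same for all graphs of the induction, since a new edge changes only the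
  arcs.\<close>

locale reducible = subcubic +
  assumes smaller: "W \<subset> V \<Longrightarrow> outer_drawing W E' p c' F \<Longrightarrow> (\<And>v. v \<in> W \<Longrightarrow> degree E' v \<le> 3) \<Longrightarrow>
    \<exists>g h. labelling W E' g h"
begin

lemma deleted:
  assumes "W \<subset> V"
  obtains g h where "labelling W {e \<in> E. e \<subseteq> W} g h"
proof -
  let ?E = "{e \<in> E. e \<subseteq> W}"
  have o: "outer_drawing W ?E p c F"
    by (rule outer_drawing_subgraph[OF outer]) (use assms in auto)
  then have fs: "finite_simple_graph W ?E" unfolding outer_drawing_def by blast
  have "degree ?E v \<le> 3" if "v \<in> W" for v
  proof -
    have "card (nbrs ?E v) \<le> card (nbrs E v)" using finite_nbrs by (intro card_mono) (auto simp: nbrs_def)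
    then show ?thesis
      using degree_eq_card_nbrs[OF fs, of v] degree_eq_card_nbrs[OF graph, of v] degree_le[of v] that assms
      by auto
  qed
  then show ?thesis using smaller[OF assms o] that by blast
qed

text \<open>The new edge makes up for an edge into the deleted part, leading to \<open>a'\<close> or
  \<open>b'\<close>, so no degree grows.\<close>

lemma shortcut:
  assumes "W \<subset> V" "path_between E a us b" "set us \<inter> W = {a, b}" "a \<noteq> b" "{a, b} \<notin> E"
    and out: "{a, a'} \<in> E" "a' \<notin> W" "{b, b'} \<in> E" "b' \<notin> W"
  obtains g h where "labelling W (insert {a, b} {e \<in> E. e \<subseteq> W}) g h"
proof -
  let ?E = "{e \<in> E. e \<subseteq> W}" and ?E' = "insert {a, b} {e \<in> E. e \<subseteq> W}"
  have "\<exists>c'. outer_drawing W ?E' p c' F"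
    by (rule outer_drawing_shortcut[OF outer _ _ _ assms(2-4)]) (use assms(1,5) in auto)
  then obtain c' where o: "outer_drawing W ?E' p c' F" ..
  then have fs: "finite_simple_graph W ?E'" unfolding outer_drawing_def by blast
  have "degree ?E' v \<le> 3" if v: "v \<in> W" for v
  proof -
    have new: "card (nbrs ?E' v) \<le> card (nbrs E v)"
      if "w = a \<and> w' = b \<and> x = a' \<or> w = b \<and> w' = a \<and> x = b'" "v = w" for w w' x
    proof -
      have "nbrs ?E' v \<subseteq> insert w' (nbrs E v - {x})" using that out assms(4) by (auto simp: nbrs_def doubleton_eq_iff)
      then have "card (nbrs ?E' v) \<le> card (insert w' (nbrs E v - {x}))"
        using finite_nbrs by (intro card_mono) auto
      also have "\<dots> \<le> Suc (card (nbrs E v - {x}))" by (rule card_insert_le_m1) (use finite_nbrs in auto)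
      also have "\<dots> = card (nbrs E v)"
        using that out finite_nbrs by (intro card_Suc_Diff1) (auto simp: nbrs_def)
      finally show ?thesis .
    qed
    have "card (nbrs ?E' v) \<le> card (nbrs E v)"
    proof (cases "v = a \<or> v = b")
      case True
      then show ?thesis using new by blast
    next
      case False
      then show ?thesis using finite_nbrs by (intro card_mono) (auto simp: nbrs_def doubleton_eq_iff)
    qed
    then show ?thesis
      using degree_eq_card_nbrs[OF fs, of v] degree_eq_card_nbrs[OF graph, of v] degree_le[of v] v assms(1)
      by auto
  qed
  then show ?thesis using smaller[OF assms(1) o] that by blast
qed

text \<open>The vertex is put back last. Its neighbour has at most two other edges, while
  \<open>label_three\<close> offers three labels for the restored edge.\<close>

lemma low_degree:
  assumes v: "v \<in> V" "degree E v < 2"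
  shows "\<exists>g h. labelling V E g h"
proof -
  let ?W = "V - {v}"
  obtain g h where lab: "labelling ?W {e \<in> E. e \<subseteq> ?W} g h" using deleted[of ?W] v by blast
  show ?thesis
  proof (cases "nbrs E v = {}")
    case True
    then have no: "{v, u} \<notin> E" "{u, v} \<notin> E" for u by (auto simp: nbrs_def insert_commute)
    have "0 \<in> labels" by (simp add: labels_def)
    moreover have "e \<subseteq> V - {v}" if "e \<in> E" for e
      using no edge_other_end[OF graph that, of v] edge(1)[OF that] that by blast
    ultimately have "labelling V E (g(v := 0)) h"
      by (intro relabel_inside[OF lab, where X = "{v}" and N = "{}"]) (use no in auto)
    then show ?thesis by blast
  next
    case False
    then obtain u where u: "{v, u} \<in> E" by (auto simp: nbrs_def)
    have only: "w = u" if "{v, w} \<in> E" for w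
    proof (rule ccontr)
      assume "w \<noteq> u"
      moreover have "card {u, w} \<le> card (nbrs E v)"
        using u that finite_nbrs by (intro card_mono) (auto simp: nbrs_def)
      ultimately show False using v degree_eq_card_nbrs[OF graph, of v] by simp
    qed
    have uv: "u \<in> V" "u \<noteq> v" using adjacent[OF u] by auto
    then have gu: "g u \<in> labels" using labellingD(1)[OF lab] by auto
    let ?B = "(\<lambda>w. h {u, w}) ` (nbrs E u - {v})"
    have "card (nbrs E u) \<le> 3" using degree_le[OF uv(1)] degree_eq_card_nbrs[OF graph, of u] by simp
    then have "card (nbrs E u - {v}) \<le> 2"
      using u finite_nbrs[of u] by (simp add: nbrs_def insert_commute card_Diff_singleton_if)
    then have B: "card ?B \<le> 2" using card_image_le[of "nbrs E u - {v}" "\<lambda>w. h {u, w}"] finite_nbrs by force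
    obtain e1 e2 e3 where e123: "e1 \<in> labels" "e2 \<in> labels" "e3 \<in> labels" "far (g u) e1" "far (g u) e2" "far (g u) e3"
      "distinct [e1, e2, e3]"
      using label_three gu by (metis distinct_length_2_or_more distinct_singleton)
    have "\<not> {e1, e2, e3} \<subseteq> ?B"
    proof
      assume "{e1, e2, e3} \<subseteq> ?B"
      then have "card {e1, e2, e3} \<le> card ?B" using finite_nbrs by (intro card_mono) auto
      then show False using B e123(7) by simp
    qed
    then obtain m where m: "m \<in> labels" "far (g u) m" "m \<notin> ?B" using e123 by blast
    obtain x where x: "x \<in> labels" "x \<noteq> g u" "far x m" using label_leaf gu m(1) by blast
    have "labelling V E (g(v := x)) (h({v, u} := m))"
    proof (rule relabel[OF lab, where X = "{v}" and N = "{{v, u}}"])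
      have "v \<in> e \<Longrightarrow> e = {v, u}" if "e \<in> E" for e
        using edge_other_end[OF graph that, of v] only that by auto
      then show "E \<subseteq> {e \<in> E. e \<subseteq> V - {v}} \<union> {{v, u}}" using edge(1) by blast
    next
      fix v' u' w assume a: "v' \<notin> {v}" "{v', u'} \<in> {{v, u}}" "{v', w} \<in> E" "u' \<noteq> w"
      then have "v' = u" "u' = v" by (auto simp: doubleton_eq_iff)
      then show "(h({v, u} := m)) {v', u'} \<noteq> (h({v, u} := m)) {v', w}"
        using a m(3) uv by (auto simp: nbrs_def doubleton_eq_iff insert_commute)
    qed (use x m uv only in \<open>auto simp: doubleton_eq_iff insert_commute\<close>)
    then show ?thesis by blast
  qed
qed

text \<open>If \<open>x\<close> and \<open>y\<close> are adjacent, only \<open>u\<close> and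
  \<open>v\<close> are deleted, but the whole quadrilateral is relabelled. The outside then enters
  through the third neighbours of \<open>x\<close> and \<open>y\<close> alone.\<close>

lemma thread:
  assumes dist: "distinct [x, u, v, y]" and xu: "{x, u} \<in> E" and uv: "{u, v} \<in> E" and vy: "{v, y} \<in> E"
    and deg: "degree E u = 2" "degree E v = 2"
  shows "\<exists>g h. labelling V E g h"
proof -
  let ?W = "V - {u, v}"
  have V: "x \<in> V" "u \<in> V" "v \<in> V" "y \<in> V" using adjacent xu uv vy by blast+
  have ne: "x \<noteq> u" "x \<noteq> v" "x \<noteq> y" "u \<noteq> v" "u \<noteq> y" "v \<noteq> y" using dist by auto
  have comm: "{u, x} \<in> E" "{v, u} \<in> E" "{y, v} \<in> E" using xu uv vy by (simp_all add: insert_commute)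
  have nu: "{u, w} \<in> E \<Longrightarrow> w = x \<or> w = v" for w
    using nbrs_of_degree_two[OF deg(1) comm(1) uv] ne by auto
  have nv: "{v, w} \<in> E \<Longrightarrow> w = u \<or> w = y" for w
    using nbrs_of_degree_two[OF deg(2) comm(2) vy] ne by auto
  have eu: "e = {x, u} \<or> e = {u, v}" if "e \<in> E" "u \<in> e" for e
    using edge_other_end[OF graph that] nu that by (auto simp: insert_commute)
  have ev: "e = {u, v} \<or> e = {v, y}" if "e \<in> E" "v \<in> e" for e
    using edge_other_end[OF graph that] nv that by (auto simp: insert_commute)
  show ?thesis
  proof (cases "{x, y} \<in> E")
    case False
    have "path_between E x [x, u, v, y] y" using dist xu uv vy by (auto simp: path_between_def)
    moreover have "set [x, u, v, y] \<inter> ?W = {x, y}" using ne V by auto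
    ultimately obtain g h where lab: "labelling ?W (insert {x, y} {e \<in> E. e \<subseteq> ?W}) g h"
      using shortcut[of ?W x "[x, u, v, y]" y u v] ne V False xu comm by auto
    note L = labellingD[OF lab]
    \<comment> \<open>Both \<open>xu\<close> and \<open>vy\<close> inherit the label of the joining
      edge. It already differs from the labels of the other edges at \<open>x\<close> and
      \<open>y\<close>, and its ends have different labels.\<close>
    let ?e = "h {x, y}"
    have "?e \<in> labels" "g x \<in> labels" "g y \<in> labels" "far (g x) ?e" "far (g y) ?e" "g x \<noteq> g y"
      using L(1)[of x] L(1)[of y] L(2)[of "{x, y}"] L(3-5)[of x y] V ne by auto
    then obtain a m b where new: "a \<in> labels" "a \<noteq> g x" "far a ?e" "m \<in> labels" "m \<noteq> ?e" "far a m"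
      "b \<in> labels" "b \<noteq> g y" "b \<noteq> a" "far b ?e" "far b m"
      using label_thread[rule_format, of "g x" ?e "g y"] by blast
    let ?g = "g(u := a, v := b)" and ?h = "h({x, u} := ?e, {u, v} := m, {v, y} := ?e)"
    have hs: "?h {x, u} = ?e" "?h {u, x} = ?e" "?h {u, v} = m" "?h {v, u} = m" "?h {v, y} = ?e" "?h {y, v} = ?e"
      using ne by (auto simp: doubleton_eq_iff)
    have ho: "w \<notin> {u, v} \<Longrightarrow> w' \<notin> {u, v} \<Longrightarrow> ?h {w, w'} = h {w, w'}" for w w'
      by (auto simp: doubleton_eq_iff)
    have hx: "?e \<noteq> h {x, w}" if "{x, w} \<in> E" "w \<noteq> u" "w \<noteq> v" for w
      using L(6)[of x y w] that False adjacent[OF that(1)] ne by auto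
    have hy: "?e \<noteq> h {y, w}" if "{y, w} \<in> E" "w \<noteq> u" "w \<noteq> v" for w
      using L(6)[of y x w] that False adjacent[OF that(1)] ne by (auto simp: insert_commute)
    have nxy: "{x, v} \<notin> E" "{y, u} \<notin> E" using nu nv ne by (metis insert_commute)+
    have "labelling V E ?g ?h"
    proof (rule relabel[OF lab, where X = "{u, v}" and N = "{{x, u}, {u, v}, {v, y}}"])
      show "E \<subseteq> insert {x, y} {e \<in> E. e \<subseteq> ?W} \<union> {{x, u}, {u, v}, {v, y}}" using eu ev edge(1) by blast
    next
      fix w w' assume "w \<in> {u, v}" "{w, w'} \<in> E"
      then show "?g w \<noteq> ?g w' \<and> far (?g w) (?h {w, w'})"
        using new ne by (auto dest!: nu nv simp: hs simp del: fun_upd_apply) auto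
    next
      fix w w' w'' assume "w \<in> {u, v}" "{w, w'} \<in> E" "{w, w''} \<in> E" "w' \<noteq> w''"
      then show "?h {w, w'} \<noteq> ?h {w, w''}"
        using new ne by (auto dest!: nu nv simp: hs simp del: fun_upd_apply)
    next
      fix w w' assume "w \<notin> {u, v}" "{w, w'} \<in> {{x, u}, {u, v}, {v, y}}"
      then have "w = x \<and> w' = u \<or> w = y \<and> w' = v" by (auto simp: doubleton_eq_iff)
      then show "w' \<in> {u, v} \<and> far (?g w) (?h {w, w'})"
        using hs ne L(4)[of x y] L(5)[of x y] by (auto simp del: fun_upd_apply simp: fun_upd_other)
    next
      fix w w' w'' assume w: "w \<notin> {u, v}" "{w, w'} \<in> {{x, u}, {u, v}, {v, y}}" "{w, w''} \<in> E" "w' \<noteq> w''"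
      then consider "w = x" "w' = u" | "w = y" "w' = v" by (auto simp: doubleton_eq_iff)
      then show "?h {w, w'} \<noteq> ?h {w, w''}"
      proof cases
        case 1
        then have "w'' \<noteq> u" "w'' \<noteq> v" using w nxy by auto
        then show ?thesis using hx[of w''] ho[of x w''] w(3) 1 ne hs(1) by simp
      next
        case 2
        then have "w'' \<noteq> u" "w'' \<noteq> v" using w nxy by auto
        then show ?thesis using hy[of w''] ho[of y w''] w(3) 2 ne hs(6) by simp
      qed
    qed (use new in \<open>auto simp: \<open>?e \<in> labels\<close>\<close>)
    then show ?thesis by blast
  next
    case True
    obtain g h where lab: "labelling ?W {e \<in> E. e \<subseteq> ?W} g h" using deleted[of ?W] V by blast
    note L = labellingD[OF lab]
    have xy: "{x, y} \<in> {e \<in> E. e \<subseteq> ?W}" "{y, x} \<in> E" "{y, x} \<in> {e \<in> E. e \<subseteq> ?W}"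
      using True V ne by (auto simp: insert_commute)
    have nxy: "{x, v} \<notin> E" "{y, u} \<notin> E" using nu nv ne by (metis insert_commute)+
    have xW: "x \<in> ?W" "y \<in> ?W" using V ne by auto
    have m: "h {x, y} \<in> labels" using L(2) xy by blast
    obtain a e where ae: "a \<in> labels" "e \<in> labels" "far a e" "g x \<noteq> a" "far (g x) e"
      and nx: "\<And>w. {x, w} \<in> E \<Longrightarrow> w = u \<or> w = y \<or> (g w = a \<and> h {x, w} = e)"
      and em: "(\<And>w. {x, w} \<in> E \<Longrightarrow> w \<noteq> u \<Longrightarrow> w \<noteq> y \<Longrightarrow> h {x, w} \<noteq> h {x, y}) \<Longrightarrow> e \<noteq> h {x, y}"
      by (rule stub[OF lab xW(1) xu True _ _ m]) (use ne nxy adjacent in auto)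
    obtain b e' where be: "b \<in> labels" "e' \<in> labels" "far b e'" "g y \<noteq> b" "far (g y) e'"
      and ny: "\<And>w. {y, w} \<in> E \<Longrightarrow> w = v \<or> w = x \<or> (g w = b \<and> h {y, w} = e')"
      and em': "(\<And>w. {y, w} \<in> E \<Longrightarrow> w \<noteq> v \<Longrightarrow> w \<noteq> x \<Longrightarrow> h {y, w} \<noteq> h {x, y}) \<Longrightarrow> e' \<noteq> h {x, y}"
      by (rule stub[OF lab xW(2) comm(3) xy(2) _ _ m]) (use ne nxy adjacent in auto)
    have "e \<noteq> h {x, y}"
    proof (rule em)
      fix w assume w: "{x, w} \<in> E" "w \<noteq> u" "w \<noteq> y"
      then have "{x, w} \<in> {e \<in> E. e \<subseteq> ?W}" using nxy adjacent(2)[OF w(1)] xW by auto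
      then show "h {x, w} \<noteq> h {x, y}" using L(6)[OF _ xy(1)] w(3) by blast
    qed
    moreover have "e' \<noteq> h {x, y}"
    proof (rule em')
      fix w assume w: "{y, w} \<in> E" "w \<noteq> v" "w \<noteq> x"
      then have "{y, w} \<in> {e \<in> E. e \<subseteq> ?W}" using nxy adjacent(2)[OF w(1)] xW by auto
      then show "h {y, w} \<noteq> h {x, y}" using L(6)[OF _ xy(3)] w(3) insert_commute[of x y "{}"] by auto
    qed
    moreover have "g x \<in> labels" "g y \<in> labels" using L(1) xW by auto
    moreover have "g x \<noteq> g y" "far (g x) (h {x, y})" "far (g y) (h {x, y})"
      using L(3)[OF xy(1)] L(4)[OF xy(1)] L(5)[OF xy(1)] by simp_all
    \<comment> \<open>The old labels of \<open>x\<close>, \<open>xy\<close> and \<open>y\<close>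
      witness the premise of \<open>label_quad\<close>. For this \<open>stub\<close> was given the
      label of \<open>xy\<close> as the one to avoid.\<close>
    ultimately have "\<exists>x\<in>labels. x \<noteq> a \<and> far x e \<and> (\<exists>m\<in>labels. m \<noteq> e \<and> m \<noteq> e' \<and> far x m \<and>
        (\<exists>y\<in>labels. y \<noteq> b \<and> y \<noteq> x \<and> far y e' \<and> far y m))"
      using ae be m by metis
    then obtain cx m cy i cu j cv k where new: "cx \<in> labels" "cx \<noteq> a" "far cx e" "m \<in> labels" "m \<noteq> e" "m \<noteq> e'" "far cx m"
      "cy \<in> labels" "cy \<noteq> b" "cy \<noteq> cx" "far cy e'" "far cy m" "i \<in> labels" "i \<noteq> e" "i \<noteq> m" "far cx i"
      "cu \<in> labels" "cu \<noteq> cx" "far cu i" "j \<in> labels" "j \<noteq> e'" "j \<noteq> m" "far cy j"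
      "cv \<in> labels" "cv \<noteq> cu" "cv \<noteq> cy" "far cv j" "k \<in> labels" "k \<noteq> i" "k \<noteq> j" "far cu k" "far cv k"
      using label_quad[rule_format, OF ae(1-3) be(1-3)] by blast
    let ?X = "{x, y, u, v}" and ?N = "{{x, y}, {x, u}, {u, v}, {v, y}}"
    let ?g = "g(x := cx, y := cy, u := cu, v := cv)" and ?h = "h({x, y} := m, {x, u} := i, {u, v} := k, {v, y} := j)"
    have gs: "?g x = cx" "?g y = cy" "?g u = cu" "?g v = cv" using ne by auto
    have go: "w \<notin> ?X \<Longrightarrow> ?g w = g w" for w by auto
    have hs: "?h {x, y} = m" "?h {y, x} = m" "?h {x, u} = i" "?h {u, x} = i" "?h {u, v} = k" "?h {v, u} = k"
      "?h {v, y} = j" "?h {y, v} = j"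
      using ne by (auto simp: doubleton_eq_iff)
    have ho: "w \<notin> ?X \<Longrightarrow> ?h {w', w} = h {w', w}" for w w' by (auto simp: doubleton_eq_iff)
    have nx': "w = u \<or> w = y \<or> (w \<notin> ?X \<and> ?g w = a \<and> ?h {x, w} = e)" if "{x, w} \<in> E" for w
      using nx[OF that] adjacent(3)[OF that] nxy that go[of w] ho[of w x] by blast
    have ny': "w = v \<or> w = x \<or> (w \<notin> ?X \<and> ?g w = b \<and> ?h {y, w} = e')" if "{y, w} \<in> E" for w
      using ny[OF that] adjacent(3)[OF that] nxy that go[of w] ho[of w y] by blast
    have "labelling V E ?g ?h"
    proof (rule relabel_inside[OF lab, where X = ?X and N = ?N])
      fix e assume e: "e \<in> E" "e \<notin> ?N"
      then show "e \<subseteq> ?W" using eu ev edge(1) by blast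
    next
      fix w w' assume "w \<in> ?X" "{w, w'} \<in> E"
      then show "?g w \<noteq> ?g w' \<and> far (?g w) (?h {w, w'})"
        using new by (auto dest!: nu nv nx' ny' simp: hs gs simp del: fun_upd_apply)
    next
      fix w w' w'' assume w: "w \<in> ?X" "{w, w'} \<in> E" "{w, w''} \<in> E" "w' \<noteq> w''"
      show "?h {w, w'} \<noteq> ?h {w, w''}"
      proof -
        consider "w = x" | "w = y" | "w = u" | "w = v" using w(1) by blast
        then show ?thesis
        proof cases
          case 1
          \<comment> \<open>Reassociating the conjunction groups all but the edge label into the
            predicate \<open>P\<close> of \<open>inj_at_stub\<close>.\<close>
          show ?thesis unfolding 1 by (rule inj_at_stub[OF xu True ne(5) nx'[unfolded conj_assoc[symmetric]] hs(3,1)]) (use new w 1 in simp_all)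
        next
          case 2
          show ?thesis unfolding 2 by (rule inj_at_stub[OF comm(3) xy(2) ne(2)[symmetric] ny'[unfolded conj_assoc[symmetric]] hs(8,2)]) (use new w 2 in simp_all)
        next
          case 3
          show ?thesis unfolding 3 by (rule inj_at_two[OF nu hs(4,5)]) (use new w 3 in simp_all)
        next
          case 4
          show ?thesis unfolding 4 by (rule inj_at_two[OF nv hs(6,7)]) (use new w 4 in simp_all)
        qed
      qed
    qed (use new in auto)
    then show ?thesis by blast
  qed
qed

text \<open>Only \<open>x\<close> can have a neighbour outside the triangle. Relabelling
  \<open>x\<close> together with \<open>y\<close> and \<open>z\<close> leaves a single outside edge
  to respect.\<close>

lemma pendant_triangle:
  assumes dist: "distinct [x, y, z]" and xy: "{x, y} \<in> E" and xz: "{x, z} \<in> E" and yz: "{y, z} \<in> E"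
    and nz: "\<And>u. {z, u} \<in> E \<Longrightarrow> u = x \<or> u = y" and ny: "\<And>u. {y, u} \<in> E \<Longrightarrow> u = x \<or> u = z"
  shows "\<exists>g h. labelling V E g h"
proof -
  let ?W = "V - {y, z}"
  have ne: "x \<noteq> y" "x \<noteq> z" "y \<noteq> z" using dist by auto
  have V: "x \<in> V" "y \<in> V" "z \<in> V" using adjacent xy xz by blast+
  have ey: "e = {x, y} \<or> e = {y, z}" if "e \<in> E" "y \<in> e" for e
    using edge_other_end[OF graph that] ny that by (auto simp: insert_commute)
  have ez: "e = {x, z} \<or> e = {y, z}" if "e \<in> E" "z \<in> e" for e
    using edge_other_end[OF graph that] nz that by (auto simp: insert_commute)
  obtain g h where lab: "labelling ?W {e \<in> E. e \<subseteq> ?W} g h" using deleted[of ?W] V by blast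
  \<comment> \<open>No edge label has to be avoided at \<open>x\<close>, so 0 is passed to
    \<open>stub\<close> as an arbitrary value of \<open>m\<close>.\<close>
  have xW: "x \<in> ?W" and m0: "0 \<in> labels" using V ne by (auto simp: labels_def)
  obtain a e where ae: "a \<in> labels" "e \<in> labels" "far a e"
    and nx: "\<And>w. {x, w} \<in> E \<Longrightarrow> w = y \<or> w = z \<or> (g w = a \<and> h {x, w} = e)"
    by (rule stub[OF lab xW xy xz ne(3) _ m0]) (use adjacent in auto)
  obtain cx m cy i cz j where new: "cx \<in> labels" "cx \<noteq> a" "far cx e" "m \<in> labels" "m \<noteq> e" "far cx m"
    "cy \<in> labels" "cy \<noteq> cx" "far cy m" "i \<in> labels" "i \<noteq> e" "i \<noteq> m" "far cx i"
    "cz \<in> labels" "cz \<noteq> cx" "cz \<noteq> cy" "far cz i" "j \<in> labels" "j \<noteq> m" "j \<noteq> i" "far cy j" "far cz j"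
    using label_pendant_triangle[rule_format, OF ae] by blast
  let ?X = "{x, y, z}" and ?N = "{{x, y}, {x, z}, {y, z}}"
  let ?g = "g(x := cx, y := cy, z := cz)" and ?h = "h({x, y} := m, {x, z} := i, {y, z} := j)"
  have gs: "?g x = cx" "?g y = cy" "?g z = cz" using ne by auto
  have go: "w \<notin> ?X \<Longrightarrow> ?g w = g w" for w by auto
  have hs: "?h {x, y} = m" "?h {y, x} = m" "?h {x, z} = i" "?h {z, x} = i" "?h {y, z} = j" "?h {z, y} = j"
    using ne by (auto simp: doubleton_eq_iff)
  have ho: "w \<notin> ?X \<Longrightarrow> ?h {w', w} = h {w', w}" for w w' by (auto simp: doubleton_eq_iff)
  have nx': "w = y \<or> w = z \<or> (w \<notin> ?X \<and> ?g w = a \<and> ?h {x, w} = e)" if "{x, w} \<in> E" for w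
    using nx[OF that] adjacent(3)[OF that] go[of w] ho[of w x] by blast
  have "labelling V E ?g ?h"
  proof (rule relabel_inside[OF lab, where X = ?X and N = ?N])
    fix e assume e: "e \<in> E" "e \<notin> ?N"
    then show "e \<subseteq> ?W" using ey ez edge(1) by blast
  next
    fix w w' assume "w \<in> ?X" "{w, w'} \<in> E"
    then show "?g w \<noteq> ?g w' \<and> far (?g w) (?h {w, w'})"
      using new by (auto dest!: nx' ny nz simp: hs gs simp del: fun_upd_apply)
  next
    fix w w' w'' assume w: "w \<in> ?X" "{w, w'} \<in> E" "{w, w''} \<in> E" "w' \<noteq> w''"
    show "?h {w, w'} \<noteq> ?h {w, w''}"
    proof -
      consider "w = x" | "w = y" | "w = z" using w(1) by blast
      then show ?thesis
      proof cases
        case 1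
        show ?thesis unfolding 1 by (rule inj_at_stub[OF xy xz ne(3) nx'[unfolded conj_assoc[symmetric]] hs(1,3)]) (use new w 1 in simp_all)
      next
        case 2
        show ?thesis unfolding 2 by (rule inj_at_two[OF ny hs(2,5)]) (use new w 2 in simp_all)
      next
        case 3
        show ?thesis unfolding 3 by (rule inj_at_two[OF nz hs(4,6)]) (use new w 3 in simp_all)
      qed
    qed
  qed (use new in auto)
  then show ?thesis by blast
qed

text \<open>Unless the triangle is pendant, the third neighbours \<open>r\<close> of
  \<open>x\<close> and \<open>q\<close> of \<open>y\<close> attach it. If they coincide, a diamond
  hangs at \<open>r\<close>. If they are distinct and not adjacent, they are joined along
  \<open>r\<close>, \<open>x\<close>, \<open>y\<close>, \<open>q\<close>. If they are adjacent, they
  are relabelled too.\<close>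

lemma triangle:
  assumes dist: "distinct [x, y, z]" and xy: "{x, y} \<in> E" and xz: "{x, z} \<in> E" and yz: "{y, z} \<in> E"
    and deg: "degree E z = 2"
  shows "\<exists>g h. labelling V E g h"
proof -
  let ?W = "V - {x, y, z}"
  have ne: "x \<noteq> y" "x \<noteq> z" "y \<noteq> z" using dist by auto
  have comm: "{y, x} \<in> E" "{z, x} \<in> E" "{z, y} \<in> E" using xy xz yz by (simp_all add: insert_commute)
  have V: "x \<in> V" "y \<in> V" "z \<in> V" using adjacent xy xz by blast+
  have nz: "{z, u} \<in> E \<Longrightarrow> u = x \<or> u = y" for u
    using nbrs_of_degree_two[OF deg comm(2,3)] ne by auto
  consider "\<And>u. {y, u} \<in> E \<Longrightarrow> u = x \<or> u = z" | "\<And>u. {x, u} \<in> E \<Longrightarrow> u = y \<or> u = z"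
    | r q where "{x, r} \<in> E" "r \<noteq> y" "r \<noteq> z" "{y, q} \<in> E" "q \<noteq> x" "q \<noteq> z"
    by metis
  then show ?thesis
  proof cases
    case 1
    then show ?thesis using pendant_triangle[OF dist xy xz yz nz] by blast
  next
    case 2
    then show ?thesis using pendant_triangle[of y x z] dist comm xz yz nz by auto
  next
    case (3 r q)
    have nx: "w = y \<or> w = z \<or> w = r" if "{x, w} \<in> E" for w
      using third_unique[OF xy xz ne(3) that] 3 by blast
    have ny: "w = x \<or> w = z \<or> w = q" if "{y, w} \<in> E" for w
      using third_unique[OF comm(1) yz ne(2) that] 3 by blast
    have ex: "e = {x, y} \<or> e = {x, z} \<or> e = {x, r}" if "e \<in> E" "x \<in> e" for e
      using edge_other_end[OF graph that] nx that by auto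
    have ey: "e = {x, y} \<or> e = {y, z} \<or> e = {y, q}" if "e \<in> E" "y \<in> e" for e
      using edge_other_end[OF graph that] ny that by (auto simp: insert_commute)
    have ez: "e = {x, z} \<or> e = {y, z}" if "e \<in> E" "z \<in> e" for e
      using edge_other_end[OF graph that] nz that by (auto simp: insert_commute)
    have touching: "e \<in> {{x, y}, {x, z}, {y, z}, {x, r}, {y, q}}"
      if "e \<in> E" "x \<in> e \<or> y \<in> e \<or> z \<in> e" for e
      unfolding insert_iff using ex[of e] ey[of e] ez[of e] that by argo
    have rq: "{r, x} \<in> E" "{q, y} \<in> E" "r \<noteq> x" "q \<noteq> y" "r \<in> V" "q \<in> V"
      using 3 adjacent by (auto simp: insert_commute)
    have rW: "r \<in> ?W" "q \<in> ?W" using 3 rq by auto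
    have m0: "0 \<in> labels" by (simp add: labels_def)
    consider "r = q" | "r \<noteq> q" "{r, q} \<notin> E" | "r \<noteq> q" "{r, q} \<in> E" by blast
    then show ?thesis
    proof cases
      case 1
      then have ry: "{r, y} \<in> E" using rq by simp
      have rz: "{r, z} \<notin> E" using nz[of r] rq 3 1 by (metis insert_commute)
      obtain g h where lab: "labelling ?W {e \<in> E. e \<subseteq> ?W} g h" using deleted[of ?W] V by blast
      obtain a e where ae: "a \<in> labels" "e \<in> labels" "far a e"
        and nr: "\<And>w. {r, w} \<in> E \<Longrightarrow> w = x \<or> w = y \<or> (g w = a \<and> h {r, w} = e)"
        by (rule stub[OF lab rW(1) rq(1) ry ne(1) _ m0]) (use adjacent rz in auto)
      obtain cr k l cx m cy i cz j where new: "cr \<in> labels" "cr \<noteq> a" "far cr e" "k \<in> labels" "k \<noteq> e" "far cr k"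
        "l \<in> labels" "l \<noteq> e" "l \<noteq> k" "far cr l" "cx \<in> labels" "cx \<noteq> cr" "far cx k"
        "m \<in> labels" "m \<noteq> k" "m \<noteq> l" "far cx m" "cy \<in> labels" "cy \<noteq> cr" "cy \<noteq> cx" "far cy l" "far cy m"
        "i \<in> labels" "i \<noteq> k" "i \<noteq> m" "far cx i" "cz \<in> labels" "cz \<noteq> cx" "cz \<noteq> cy" "far cz i"
        "j \<in> labels" "j \<noteq> l" "j \<noteq> m" "j \<noteq> i" "far cy j" "far cz j"
        using label_pendant_diamond[rule_format, OF ae] by blast
      let ?X = "{x, y, z, r}" and ?N = "{{x, y}, {x, z}, {y, z}, {x, r}, {y, r}}"
      let ?g = "g(x := cx, y := cy, z := cz, r := cr)"
        and ?h = "h({x, y} := m, {x, z} := i, {y, z} := j, {x, r} := k, {y, r} := l)"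
      have ne': "r \<noteq> x" "r \<noteq> y" "r \<noteq> z" using 3 rq by auto
      have gs: "?g x = cx" "?g y = cy" "?g z = cz" "?g r = cr" using ne ne' by auto
      have go: "w \<notin> ?X \<Longrightarrow> ?g w = g w" for w by auto
      have hs: "?h {x, y} = m" "?h {y, x} = m" "?h {x, z} = i" "?h {z, x} = i" "?h {y, z} = j" "?h {z, y} = j"
        "?h {x, r} = k" "?h {r, x} = k" "?h {y, r} = l" "?h {r, y} = l"
        using ne ne' by (auto simp: doubleton_eq_iff)
      have ho: "w \<notin> ?X \<Longrightarrow> ?h {w', w} = h {w', w}" for w w' by (auto simp: doubleton_eq_iff)
      have nr': "w = x \<or> w = y \<or> (w \<notin> ?X \<and> ?g w = a \<and> ?h {r, w} = e)" if "{r, w} \<in> E" for w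
        using nr[OF that] adjacent(3)[OF that] go[of w] ho[of w r] rz that by blast
      have ny': "w = x \<or> w = z \<or> w = r" if "{y, w} \<in> E" for w using ny[OF that] 1 by simp
      have "labelling V E ?g ?h"
      proof (rule relabel_inside[OF lab, where X = ?X and N = ?N])
        fix e assume e: "e \<in> E" "e \<notin> ?N"
        then have "x \<notin> e" "y \<notin> e" "z \<notin> e" using touching[OF e(1)] unfolding 1 by blast+
        then show "e \<subseteq> ?W" using edge(1)[OF e(1)] by blast
      next
        fix w w' assume "w \<in> ?X" "{w, w'} \<in> E"
        then show "?g w \<noteq> ?g w' \<and> far (?g w) (?h {w, w'})"
          using new by (auto dest!: nx ny' nz nr' simp: hs gs simp del: fun_upd_apply)
      next
        fix w w' w'' assume w: "w \<in> ?X" "{w, w'} \<in> E" "{w, w''} \<in> E" "w' \<noteq> w''"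
        show "?h {w, w'} \<noteq> ?h {w, w''}"
        proof -
          consider "w = x" | "w = y" | "w = z" | "w = r" using w(1) by blast
          then show ?thesis
          proof cases
            case 1
            show ?thesis unfolding 1 by (rule inj_at_three[OF nx hs(1,3,7)]) (use new w 1 in simp_all)
          next
            case 2
            show ?thesis unfolding 2 by (rule inj_at_three[OF ny' hs(2,5,9)]) (use new w 2 in simp_all)
          next
            case 3
            show ?thesis unfolding 3 by (rule inj_at_two[OF nz hs(4,6)]) (use new w 3 in simp_all)
          next
            case 4
            show ?thesis unfolding 4 by (rule inj_at_stub[OF rq(1) ry ne(1) nr'[unfolded conj_assoc[symmetric]] hs(8,10)]) (use new w 4 in simp_all)
          qed
        qed
      qed (use new in auto)
      then show ?thesis by blast
    next
      case 2
      have "path_between E r [r, x, y, q] q"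
        using 3 rq xy 2 ne by (auto simp: path_between_def)
      moreover have "set [r, x, y, q] \<inter> ?W = {r, q}" using rW by auto
      moreover have "?W \<subset> V" using V by blast
      ultimately obtain g h where lab: "labelling ?W (insert {r, q} {e \<in> E. e \<subseteq> ?W}) g h"
        using shortcut[of ?W r "[r, x, y, q]" q x y] 2 V rq by auto
      note L = labellingD[OF lab]
      \<comment> \<open>As in \<open>thread\<close>, the joining edge passes its label on to both
        \<open>xr\<close> and \<open>yq\<close>.\<close>
      let ?e = "h {r, q}"
      have "?e \<in> labels" "g r \<in> labels" "g q \<in> labels" "far (g r) ?e" "far (g q) ?e" "g r \<noteq> g q"
        using L(1)[of r] L(1)[of q] L(2)[of "{r, q}"] L(3-5)[of r q] rW by auto
      note e = this
      then obtain cx m cy i cz j where new: "cx \<in> labels" "cx \<noteq> g r" "far cx ?e" "m \<in> labels" "m \<noteq> ?e" "far cx m"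
        "cy \<in> labels" "cy \<noteq> g q" "cy \<noteq> cx" "far cy ?e" "far cy m" "i \<in> labels" "i \<noteq> ?e" "i \<noteq> m" "far cx i"
        "cz \<in> labels" "cz \<noteq> cx" "cz \<noteq> cy" "far cz i" "j \<in> labels" "j \<noteq> ?e" "j \<noteq> m" "j \<noteq> i" "far cy j" "far cz j"
        using label_triangle[rule_format, OF e(2,1,4,3,5,6)] by blast
      let ?X = "{x, y, z}" and ?N = "{{x, y}, {x, z}, {y, z}, {x, r}, {y, q}}"
      let ?g = "g(x := cx, y := cy, z := cz)"
        and ?h = "h({x, y} := m, {x, z} := i, {y, z} := j, {x, r} := ?e, {y, q} := ?e)"
      have ne': "r \<noteq> x" "r \<noteq> y" "r \<noteq> z" "q \<noteq> x" "q \<noteq> y" "q \<noteq> z" using 3 rq by auto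
      have gs: "?g x = cx" "?g y = cy" "?g z = cz" "?g r = g r" "?g q = g q" using ne ne' by auto
      have hs: "?h {x, y} = m" "?h {y, x} = m" "?h {x, z} = i" "?h {z, x} = i" "?h {y, z} = j" "?h {z, y} = j"
        "?h {x, r} = ?e" "?h {r, x} = ?e" "?h {y, q} = ?e" "?h {q, y} = ?e"
        using ne ne' by (auto simp: doubleton_eq_iff)
      have ho: "w \<notin> ?X \<Longrightarrow> w' \<notin> ?X \<Longrightarrow> ?h {w, w'} = h {w, w'}" for w w'
        by (auto simp: doubleton_eq_iff)
      have off: "{r, y} \<notin> E" "{r, z} \<notin> E" "{q, x} \<notin> E" "{q, z} \<notin> E"
        using nx[of q] ny[of r] nz[of r] nz[of q] ne' 2 by (metis insert_commute)+
      have hr: "?e \<noteq> h {r, w}" if "{r, w} \<in> E" "w \<noteq> x" for w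
      proof -
        have "w \<in> ?W" "w \<noteq> q" using that off 2 adjacent(2)[OF that(1)] by auto
        then show ?thesis using L(6)[of r q w] that(1) rW by auto
      qed
      have hq: "?e \<noteq> h {q, w}" if "{q, w} \<in> E" "w \<noteq> y" for w
      proof -
        have "w \<in> ?W" "w \<noteq> r" using that off 2 adjacent(2)[OF that(1)] by (auto simp: insert_commute)
        then show ?thesis using L(6)[of q r w] that(1) rW by (auto simp: insert_commute)
      qed
      have "labelling V E ?g ?h"
      proof (rule relabel[OF lab, where X = ?X and N = ?N])
        show "E \<subseteq> insert {r, q} {e \<in> E. e \<subseteq> ?W} \<union> ?N"
        proof
          fix e assume e: "e \<in> E"
          show "e \<in> insert {r, q} {e \<in> E. e \<subseteq> ?W} \<union> ?N"
          proof (cases "x \<in> e \<or> y \<in> e \<or> z \<in> e")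
            case True
            then show ?thesis using touching[OF e] by (intro UnI2) simp
          next
            case False
            then have "e \<subseteq> ?W" using edge(1)[OF e] by blast
            then show ?thesis using e by simp
          qed
        qed
      next
        fix w w' assume "w \<in> ?X" "{w, w'} \<in> E"
        then show "?g w \<noteq> ?g w' \<and> far (?g w) (?h {w, w'})"
          using new by (auto dest!: nx ny nz simp: hs gs simp del: fun_upd_apply)
      next
        fix w w' w'' assume w: "w \<in> ?X" "{w, w'} \<in> E" "{w, w''} \<in> E" "w' \<noteq> w''"
        show "?h {w, w'} \<noteq> ?h {w, w''}"
        proof -
          consider "w = x" | "w = y" | "w = z" using w(1) by blast
          then show ?thesis
          proof cases
            case 1
            show ?thesis unfolding 1 by (rule inj_at_three[OF nx hs(1,3,7)]) (use new w 1 in simp_all)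
          next
            case 2
            show ?thesis unfolding 2 by (rule inj_at_three[OF ny hs(2,5,9)]) (use new w 2 in simp_all)
          next
            case 3
            show ?thesis unfolding 3 by (rule inj_at_two[OF nz hs(4,6)]) (use new w 3 in simp_all)
          qed
        qed
      next
        fix w w' assume "w \<notin> ?X" "{w, w'} \<in> ?N"
        then consider "w = r" "w' = x" | "w = q" "w' = y" by (auto simp: doubleton_eq_iff)
        then show "w' \<in> ?X \<and> far (?g w) (?h {w, w'})"
          by cases (use e hs gs in \<open>simp_all del: fun_upd_apply\<close>)
      next
        fix w w' w'' assume w: "w \<notin> ?X" "{w, w'} \<in> ?N" "{w, w''} \<in> E" "w' \<noteq> w''"
        then consider "w = r" "w' = x" | "w = q" "w' = y" by (auto simp: doubleton_eq_iff)
        then show "?h {w, w'} \<noteq> ?h {w, w''}"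
        proof cases
          case 1
          then have "w'' \<notin> ?X" using w off by auto
          then show ?thesis using hr[of w''] ho[of r w''] w 1 hs(8) ne' by simp
        next
          case 2
          then have "w'' \<notin> ?X" using w off by auto
          then show ?thesis using hq[of w''] ho[of q w''] w 2 hs(10) ne' by simp
        qed
      qed (use new e in auto)
      then show ?thesis by blast
    next
      case 4: 3
      then have qr: "{r, q} \<in> E" "{q, r} \<in> E" by (simp_all add: insert_commute)
      have ne': "r \<noteq> x" "r \<noteq> y" "r \<noteq> z" "q \<noteq> x" "q \<noteq> y" "q \<noteq> z" "r \<noteq> q" using 3 rq 4 by auto
      have off: "{r, y} \<notin> E" "{r, z} \<notin> E" "{q, x} \<notin> E" "{q, z} \<notin> E"
        using nx[of q] ny[of r] nz[of r] nz[of q] ne' by (metis insert_commute)+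
      obtain g h where lab: "labelling ?W {e \<in> E. e \<subseteq> ?W} g h" using deleted[of ?W] V by blast
      note L = labellingD[OF lab]
      have rqW: "{r, q} \<in> {e \<in> E. e \<subseteq> ?W}" "{q, r} \<in> {e \<in> E. e \<subseteq> ?W}" using qr rW by auto
      have n: "h {r, q} \<in> labels" using L(2) rqW by blast
      obtain a e where ae: "a \<in> labels" "e \<in> labels" "far a e" "g r \<noteq> a" "far (g r) e"
        and nr: "\<And>w. {r, w} \<in> E \<Longrightarrow> w = x \<or> w = q \<or> (g w = a \<and> h {r, w} = e)"
        and em: "(\<And>w. {r, w} \<in> E \<Longrightarrow> w \<noteq> x \<Longrightarrow> w \<noteq> q \<Longrightarrow> h {r, w} \<noteq> h {r, q}) \<Longrightarrow> e \<noteq> h {r, q}"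
        by (rule stub[OF lab rW(1) rq(1) qr(1) _ _ n]) (use ne' off adjacent in auto)
      obtain b e' where be: "b \<in> labels" "e' \<in> labels" "far b e'" "g q \<noteq> b" "far (g q) e'"
        and nq: "\<And>w. {q, w} \<in> E \<Longrightarrow> w = y \<or> w = r \<or> (g w = b \<and> h {q, w} = e')"
        and em': "(\<And>w. {q, w} \<in> E \<Longrightarrow> w \<noteq> y \<Longrightarrow> w \<noteq> r \<Longrightarrow> h {q, w} \<noteq> h {r, q}) \<Longrightarrow> e' \<noteq> h {r, q}"
        by (rule stub[OF lab rW(2) rq(2) qr(2) _ _ n]) (use ne' off adjacent in auto)
      have "e \<noteq> h {r, q}"
      proof (rule em)
        fix w assume w: "{r, w} \<in> E" "w \<noteq> x" "w \<noteq> q"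
        then have "{r, w} \<in> {e \<in> E. e \<subseteq> ?W}" using off adjacent(2)[OF w(1)] rW by auto
        then show "h {r, w} \<noteq> h {r, q}" using L(6)[OF _ rqW(1)] w(3) by blast
      qed
      moreover have "e' \<noteq> h {r, q}"
      proof (rule em')
        fix w assume w: "{q, w} \<in> E" "w \<noteq> y" "w \<noteq> r"
        then have "{q, w} \<in> {e \<in> E. e \<subseteq> ?W}" using off adjacent(2)[OF w(1)] rW by auto
        then show "h {q, w} \<noteq> h {r, q}" using L(6)[OF _ rqW(2)] w(3) insert_commute[of r q "{}"] by auto
      qed
      moreover have "g r \<in> labels" "g q \<in> labels" using L(1) rW by auto
      moreover have "g r \<noteq> g q" "far (g r) (h {r, q})" "far (g q) (h {r, q})"
        using L(3)[OF rqW(1)] L(4)[OF rqW(1)] L(5)[OF rqW(1)] by simp_all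
      \<comment> \<open>Again the old labels, now of \<open>r\<close>, \<open>rq\<close> and
        \<open>q\<close>, are the witnesses.\<close>
      ultimately have "\<exists>x\<in>labels. x \<noteq> a \<and> far x e \<and> (\<exists>m\<in>labels. m \<noteq> e \<and> m \<noteq> e' \<and> far x m \<and>
          (\<exists>y\<in>labels. y \<noteq> b \<and> y \<noteq> x \<and> far y e' \<and> far y m))"
        using ae be n by metis
      then obtain cr n cq k l cx m cy i cz j where new: "cr \<in> labels" "cr \<noteq> a" "far cr e"
        "n \<in> labels" "n \<noteq> e" "n \<noteq> e'" "far cr n" "cq \<in> labels" "cq \<noteq> b" "cq \<noteq> cr" "far cq e'" "far cq n"
        "k \<in> labels" "k \<noteq> e" "k \<noteq> n" "far cr k" "l \<in> labels" "l \<noteq> e'" "l \<noteq> n" "far cq l"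
        "cx \<in> labels" "cx \<noteq> cr" "far cx k" "m \<in> labels" "m \<noteq> k" "m \<noteq> l" "far cx m"
        "cy \<in> labels" "cy \<noteq> cq" "cy \<noteq> cx" "far cy l" "far cy m" "i \<in> labels" "i \<noteq> k" "i \<noteq> m" "far cx i"
        "cz \<in> labels" "cz \<noteq> cx" "cz \<noteq> cy" "far cz i" "j \<in> labels" "j \<noteq> l" "j \<noteq> m" "j \<noteq> i" "far cy j" "far cz j"
        using label_capped_quad[rule_format, OF ae(1-3) be(1-3)] by blast
      let ?X = "{x, y, z, r, q}" and ?N = "{{x, y}, {x, z}, {y, z}, {x, r}, {y, q}, {r, q}}"
      let ?g = "g(x := cx, y := cy, z := cz, r := cr, q := cq)"
        and ?h = "h({x, y} := m, {x, z} := i, {y, z} := j, {x, r} := k, {y, q} := l, {r, q} := n)"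
      have gs: "?g x = cx" "?g y = cy" "?g z = cz" "?g r = cr" "?g q = cq" using ne ne' by auto
      have go: "w \<notin> ?X \<Longrightarrow> ?g w = g w" for w by auto
      have hs: "?h {x, y} = m" "?h {y, x} = m" "?h {x, z} = i" "?h {z, x} = i" "?h {y, z} = j" "?h {z, y} = j"
        "?h {x, r} = k" "?h {r, x} = k" "?h {y, q} = l" "?h {q, y} = l" "?h {r, q} = n" "?h {q, r} = n"
        using ne ne' by (simp_all add: doubleton_eq_iff)
      have ho: "w \<notin> ?X \<Longrightarrow> ?h {w', w} = h {w', w}" for w w' by (auto simp: doubleton_eq_iff)
      have nr': "w = x \<or> w = q \<or> (w \<notin> ?X \<and> ?g w = a \<and> ?h {r, w} = e)" if "{r, w} \<in> E" for w
        using nr[OF that] adjacent(3)[OF that] go[of w] ho[of w r] off that by blast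
      have nq': "w = y \<or> w = r \<or> (w \<notin> ?X \<and> ?g w = b \<and> ?h {q, w} = e')" if "{q, w} \<in> E" for w
        using nq[OF that] adjacent(3)[OF that] go[of w] ho[of w q] off that by blast
      have "labelling V E ?g ?h"
      proof (rule relabel_inside[OF lab, where X = ?X and N = ?N])
        fix e assume e: "e \<in> E" "e \<notin> ?N"
        have "\<not> (x \<in> e \<or> y \<in> e \<or> z \<in> e)"
          using touching[OF e(1)] e(2) unfolding insert_iff by argo
        then show "e \<subseteq> ?W" using edge(1)[OF e(1)] by blast
      next
        fix w w' assume "w \<in> ?X" "{w, w'} \<in> E"
        then show "?g w \<noteq> ?g w' \<and> far (?g w) (?h {w, w'})"
          using new by (auto dest!: nx ny nz nr' nq' simp: hs gs simp del: fun_upd_apply)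
      next
        fix w w' w'' assume w: "w \<in> ?X" "{w, w'} \<in> E" "{w, w''} \<in> E" "w' \<noteq> w''"
        show "?h {w, w'} \<noteq> ?h {w, w''}"
        proof -
          consider "w = x" | "w = y" | "w = z" | "w = r" | "w = q" using w(1) by blast
          then show ?thesis
          proof cases
            case 1
            show ?thesis unfolding 1 by (rule inj_at_three[OF nx hs(1,3,7)]) (use new w 1 in simp_all)
          next
            case 2
            show ?thesis unfolding 2 by (rule inj_at_three[OF ny hs(2,5,9)]) (use new w 2 in simp_all)
          next
            case 3
            show ?thesis unfolding 3 by (rule inj_at_two[OF nz hs(4,6)]) (use new w 3 in simp_all)
          next
            case 4
            show ?thesis unfolding 4 by (rule inj_at_stub[OF rq(1) qr(1) ne'(4)[symmetric] nr'[unfolded conj_assoc[symmetric]] hs(8,11)]) (use new w 4 in simp_all)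
          next
            case 5
            show ?thesis unfolding 5 by (rule inj_at_stub[OF rq(2) qr(2) ne'(2)[symmetric] nq'[unfolded conj_assoc[symmetric]] hs(10,12)]) (use new w 5 in simp_all)
          qed
        qed
      next
        show "V \<subseteq> ?W \<union> ?X" by blast
      next
        fix w assume w: "w \<in> ?X"
        show "?g w \<in> labels" by (intro fun_upd_in) (use new w in simp_all)
      next
        fix e assume e: "e \<in> ?N"
        then show "e \<subseteq> ?X" by (elim insertE emptyE) simp_all
        show "?h e \<in> labels" by (intro fun_upd_in) (use new e in simp_all)
      qed simp_all
      then show ?thesis by blast
    qed
  qed
qed

end

section \<open>The induction and the bound\<close>

lemma labelling_exists:
  assumes "outer_drawing V E p c F" "\<And>v. v \<in> V \<Longrightarrow> degree E v \<le> 3"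
  shows "\<exists>g h. labelling V E g h"
  using assms
proof (induction "card V" arbitrary: V E c rule: less_induct)
  case less
  have "finite V" using less.prems(1) by (auto simp: outer_drawing_def finite_simple_graph_def)
  \<comment> \<open>A proper subset of the finite set \<open>V\<close> has fewer elements, which
    turns the induction hypothesis into \<open>smaller\<close>.\<close>
  then interpret reducible V E p c F
    using less.hyps less.prems psubset_card_mono by unfold_locales blast+
  show ?case
  proof (cases "V = {}")
    case True
    then have "E = {}" using edge(1,2) by (metis card.empty ex_in_conv subset_empty zero_neq_numeral)
    then show ?thesis using True by (intro exI) (simp add: labelling_def)
  next
    case nonempty: False
    show ?thesis
    proof (cases "\<exists>v\<in>V. degree E v < 2")
      case True
      then show ?thesis using low_degree by blast
    next
      case False
      then interpret small_degree V E p c F by unfold_locales auto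
      show ?thesis using triangle_or_thread[OF nonempty] triangle thread by blast
    qed
  qed
qed

lemma total_labeling_of_labelling:
  assumes "finite_simple_graph V E" "labelling V E g h"
  shows "total_labeling_2_1 V E 5 (case_sum g h)"
  unfolding total_labeling_2_1_def
proof (intro conjI ballI impI)
  note L = labellingD[OF assms(2)]
  show "case_sum g h \<in> V <+> E \<rightarrow> {0..5}"
    using L(1,2) by (fastforce simp: labels_def)
  show "1 \<le> \<bar>int (case_sum g h (Inl u)) - int (case_sum g h (Inl v))\<bar>" if "{u, v} \<in> E" for u v
    using L(3)[OF that] by simp
  show "2 \<le> \<bar>int (case_sum g h (Inl v)) - int (case_sum g h (Inr e))\<bar>" if e: "e \<in> E" "v \<in> e" for v e
  proof -
    obtain u where "e = {v, u}" using edge_other_end[OF assms(1) e] by blast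
    then have "far (g v) (h e)" using L(4) e(1) by blast
    then show ?thesis unfolding far_def by simp linarith
  qed
  show "1 \<le> \<bar>int (case_sum g h (Inr e)) - int (case_sum g h (Inr e'))\<bar>"
    if e: "e \<in> E" "e' \<in> E" "e \<noteq> e' \<and> e \<inter> e' \<noteq> {}" for e e'
  proof -
    obtain v where v: "v \<in> e" "v \<in> e'" using e(3) by blast
    obtain u w where "e = {v, u}" "e' = {v, w}"
      using edge_other_end[OF assms(1) e(1) v(1)] edge_other_end[OF assms(1) e(2) v(2)] by blast
    then show ?thesis using L(6)[of v u w] e by auto
  qed
qed

theorem theorem1:
  fixes V :: "'a set" and E :: "'a set set"
  assumes "finite_simple_graph V E"
    and "outerplanar V E"
    and "max_degree V E = 3"
  shows "total_labeling_number_2_1 V E \<le> 5 \<and> (\<exists>f. total_labeling_2_1 V E 5 f)"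
proof -
  obtain p c F where "outer_drawing V E p c F" using outer_drawing_exists[OF assms(1,2)] by blast
  moreover have "degree E v \<le> 3" if "v \<in> V" for v
  proof -
    have "degree E v \<le> max_degree V E"
      unfolding max_degree_def using that assms(1) by (intro Max_ge) (auto simp: finite_simple_graph_def)
    then show ?thesis using assms(3) by simp
  qed
  ultimately obtain g h where "labelling V E g h" using labelling_exists by blast
  then have "\<exists>f. total_labeling_2_1 V E 5 f"
    using total_labeling_of_labelling[OF assms(1)] by blast
  then show ?thesis unfolding total_labeling_number_2_1_def by (auto intro: Least_le)
qed

end
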